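(* Let $q\geq 3$ be an integer and let $G$ be a Class 1 graph with $\Delta(G)\geq 5$. If every block of $G$ is either a bipartite graph, or a $(q+1)$-degenerate graph belonging to $\mathcal{A}(q)$, then $\chi'_{trans}(G)\leq q+1$.
   Context: Graphs are finite, without loops and multiple edges. A $t$-coloring of a graph $G$ is a map $f:E(G)\to\{1,\dots,t\}$; it is proper if adjacent edges receive distinct colors. $\chi'(G)$ is the chromatic index and $\Delta(G)$ the maximum degree; $G$ is Class 1 if $\chi'(G)=\Delta(G)$. For a coloring $f$, $M(f,j)$ denotes the set of edges of color $j$. Two $t$-colorings $f,g$ differ by at most $n$ color classes if $|\{j: M(f,j)\neq M(g,j)\}|\leq n$. Two proper $t$-colorings $f,g$ are $n$-equivalent if there is a sequence $f_0=f,f_1,\dots,f_k=g$ ($k\geq 1$) of proper $t$-colorings of $G$ such that $f_i$ differs from $f_{i-1}$ by at most $n$ color classes for $i=1,\dots,k$. $\chi'_{trans}(G)$ is the minimum integer $n\geq 2$ such that any proper $\chi'(G)$-coloring of $G$ is $n$-equivalent to any other proper $\chi'(G)$-coloring of $G$. For an integer $q\geq 2$, $\mathcal{A}(q)$ is the set of graphs $G$ such that every subgraph $H$ of $G$ with $\Delta(H)\leq q$ has a proper $q$-edge-coloring. A graph is $k$-degenerate if every subgraph contains a vertex of degree at most $k$ in that subgraph. A block of $G$ is a maximal connected subgraph of $G$ that has no cutvertex of its own (so each block is a maximal 2-connected subgraph, a bridge with its ends, or an isolated vertex). *)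

theory Defs
  imports "HOL-Library.FuncSet"
begin

record 'a ugraph =
  uverts :: "'a set"
  uedges :: "'a set set"

definition fin_simple_graph :: "'a ugraph \<Rightarrow> bool" where
  "fin_simple_graph G \<longleftrightarrow>
     finite (uverts G) \<and> (\<forall>e\<in>uedges G. e \<subseteq> uverts G \<and> card e = 2)"

definition subgraph_of :: "'a ugraph \<Rightarrow> 'a ugraph \<Rightarrow> bool" where
  "subgraph_of H G \<longleftrightarrow>
     fin_simple_graph H \<and> uverts H \<subseteq> uverts G \<and> uedges H \<subseteq> uedges G"

definition vertex_degree :: "'a ugraph \<Rightarrow> 'a \<Rightarrow> nat" where
  "vertex_degree G v = card {e \<in> uedges G. v \<in> e}"

(* The inserted 0 only matters for the graph without vertices, whose maximum degree is thus 0. *)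
definition max_degree :: "'a ugraph \<Rightarrow> nat" where
  "max_degree G = Max (insert 0 (vertex_degree G ` uverts G))"

(* Colorings are extensional functions, so that two colorings are equal as soon as they agree
   on all edges of the graph. *)
definition edge_coloring :: "'a ugraph \<Rightarrow> nat \<Rightarrow> ('a set \<Rightarrow> nat) \<Rightarrow> bool" where
  "edge_coloring G t f \<longleftrightarrow> f \<in> uedges G \<rightarrow>\<^sub>E {1..t}"

definition proper_edge_coloring :: "'a ugraph \<Rightarrow> nat \<Rightarrow> ('a set \<Rightarrow> nat) \<Rightarrow> bool" where
  "proper_edge_coloring G t f \<longleftrightarrow>
     edge_coloring G t f \<and>
     (\<forall>e\<in>uedges G. \<forall>e'\<in>uedges G. e \<noteq> e' \<and> e \<inter> e' \<noteq> {} \<longrightarrow> f e \<noteq> f e')"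

definition chromatic_index :: "'a ugraph \<Rightarrow> nat" where
  "chromatic_index G = (LEAST t. \<exists>f. proper_edge_coloring G t f)"

definition class_one :: "'a ugraph \<Rightarrow> bool" where
  "class_one G \<longleftrightarrow> chromatic_index G = max_degree G"

definition color_class :: "'a ugraph \<Rightarrow> ('a set \<Rightarrow> nat) \<Rightarrow> nat \<Rightarrow> 'a set set" where
  "color_class G f j = {e \<in> uedges G. f e = j}"

definition differ_at_most ::
  "'a ugraph \<Rightarrow> nat \<Rightarrow> nat \<Rightarrow> ('a set \<Rightarrow> nat) \<Rightarrow> ('a set \<Rightarrow> nat) \<Rightarrow> bool" where
  "differ_at_most G t n f g \<longleftrightarrow>
     card {j \<in> {1..t}. color_class G f j \<noteq> color_class G g j} \<le> n"

definition n_equivalent ::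
  "'a ugraph \<Rightarrow> nat \<Rightarrow> nat \<Rightarrow> ('a set \<Rightarrow> nat) \<Rightarrow> ('a set \<Rightarrow> nat) \<Rightarrow> bool" where
  "n_equivalent G t n f g \<longleftrightarrow>
     (\<exists>(k::nat) F. 1 \<le> k \<and> F 0 = f \<and> F k = g \<and>
        (\<forall>i\<le>k. proper_edge_coloring G t (F i)) \<and>
        (\<forall>i\<in>{1..k}. differ_at_most G t n (F i) (F (i - 1))))"

definition chi_trans :: "'a ugraph \<Rightarrow> nat" where
  "chi_trans G =
     (LEAST n. 2 \<le> n \<and>
        (\<forall>f g. proper_edge_coloring G (chromatic_index G) f \<and>
               proper_edge_coloring G (chromatic_index G) g \<longrightarrow>
               n_equivalent G (chromatic_index G) n f g))"

definition class_A :: "nat \<Rightarrow> 'a ugraph set" where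
  "class_A q = {G. fin_simple_graph G \<and>
     (\<forall>H. subgraph_of H G \<and> max_degree H \<le> q \<longrightarrow> (\<exists>f. proper_edge_coloring H q f))}"

definition degenerate :: "nat \<Rightarrow> 'a ugraph \<Rightarrow> bool" where
  "degenerate k G \<longleftrightarrow>
     (\<forall>H. subgraph_of H G \<and> uverts H \<noteq> {} \<longrightarrow> (\<exists>v\<in>uverts H. vertex_degree H v \<le> k))"

definition bipartite_graph :: "'a ugraph \<Rightarrow> bool" where
  "bipartite_graph G \<longleftrightarrow>
     (\<exists>X Y. X \<union> Y = uverts G \<and> X \<inter> Y = {} \<and>
        (\<forall>e\<in>uedges G. \<exists>x\<in>X. \<exists>y\<in>Y. e = {x, y}))"

definition joined :: "'a ugraph \<Rightarrow> ('a \<times> 'a) set" where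
  "joined G = {(u, v). u \<in> uverts G \<and> v \<in> uverts G \<and> (u, v) \<in> {(x, y). {x, y} \<in> uedges G}\<^sup>*}"

definition graph_components :: "'a ugraph \<Rightarrow> 'a set set" where
  "graph_components G = uverts G // joined G"

definition connected_graph :: "'a ugraph \<Rightarrow> bool" where
  "connected_graph G \<longleftrightarrow>
     uverts G \<noteq> {} \<and> (\<forall>u\<in>uverts G. \<forall>v\<in>uverts G. (u, v) \<in> joined G)"

definition delete_vertex :: "'a ugraph \<Rightarrow> 'a \<Rightarrow> 'a ugraph" where
  "delete_vertex G v = \<lparr>uverts = uverts G - {v}, uedges = {e \<in> uedges G. v \<notin> e}\<rparr>"

definition cutvertex :: "'a ugraph \<Rightarrow> 'a \<Rightarrow> bool" where
  "cutvertex G v \<longleftrightarrow>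
     v \<in> uverts G \<and> card (graph_components (delete_vertex G v)) > card (graph_components G)"

definition block_of :: "'a ugraph \<Rightarrow> 'a ugraph \<Rightarrow> bool" where
  "block_of B G \<longleftrightarrow>
     subgraph_of B G \<and> connected_graph B \<and> (\<nexists>v. cutvertex B v) \<and>
     (\<forall>B'. subgraph_of B' G \<and> connected_graph B' \<and> (\<nexists>v. cutvertex B' v) \<and> subgraph_of B B'
        \<longrightarrow> B' = B)"

end

theory Submission imports Defs begin

text \<open>
  Edge colorings can be permuted so as to fit together at a cutvertex, and bipartite graphs belong to
  \<open>\<A>(q)\<close> by Koenig's theorem, so the hypothesis on the blocks puts \<open>G\<close> itself into \<open>\<A>(q)\<close>.

  It remains to turn a coloring \<open>f\<close> into one with a prescribed color class \<open>M\<close> of \<open>g\<close>; then this class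
  is frozen and the argument is repeated. Fix a set \<open>S\<close> of \<open>q\<close> colors and let \<open>N\<close>, initially a color
  class of \<open>f\<close>, be a matching inside the \<open>S\<close>-colored edges that covers every vertex seeing all of \<open>S\<close>,
  except for a set \<open>X\<close> of at most two vertices. Move \<open>N\<close> edge by edge along \<open>N \<triangle> M\<close>. If the next edge
  of \<open>M\<close> has a color \<open>d\<close> outside \<open>S\<close>, let \<open>H\<close> be the subgraph of the colors \<open>S \<union> {d}\<close>. After deleting
  at most two edges at \<open>X\<close>, the graph \<open>H - N\<close> has maximum degree \<open>q\<close> and hence a \<open>q\<close>-coloring; as
  \<open>q \<ge> 3\<close>, one of its color classes \<open>D\<close> avoids the at most two colors that the deletion made
  unavailable. Then \<open>H - D\<close> contains \<open>N\<close> and has maximum degree \<open>q\<close>, so it can be recolored with \<open>S\<close>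
  while \<open>D\<close> receives \<open>d\<close>; this changes \<open>q + 1\<close> classes only.
\<close>

section \<open>Degrees and colorings of edge sets\<close>

text \<open>Degrees, like the colorings below, are taken in bare sets of edges, so that color
  classes and deletions of edges need no accompanying vertex set.\<close>

definition edeg :: "'a set set \<Rightarrow> 'a \<Rightarrow> nat" where
  "edeg F v = card {e \<in> F. v \<in> e}"

definition proper_on :: "'a set set \<Rightarrow> ('a set \<Rightarrow> nat) \<Rightarrow> bool" where
  "proper_on F \<phi> \<longleftrightarrow> (\<forall>e\<in>F. \<forall>e'\<in>F. e \<noteq> e' \<and> e \<inter> e' \<noteq> {} \<longrightarrow> \<phi> e \<noteq> \<phi> e')"

text \<open>Unlike in \<open>edge_coloring\<close>, values off \<open>F\<close> are unconstrained,
  so that colorings can be composed and patched freely.\<close>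

definition edge_colorable :: "'a set set \<Rightarrow> nat \<Rightarrow> bool" where
  "edge_colorable F q \<longleftrightarrow> (\<exists>\<phi>. \<phi> \<in> F \<rightarrow> {1..q} \<and> proper_on F \<phi>)"

lemma proper_onD:
  "proper_on F \<phi> \<Longrightarrow> e \<in> F \<Longrightarrow> e' \<in> F \<Longrightarrow> v \<in> e \<Longrightarrow> v \<in> e' \<Longrightarrow> \<phi> e = \<phi> e' \<Longrightarrow> e = e'"
  unfolding proper_on_def by blast

lemma proper_on_subset: "proper_on F \<phi> \<Longrightarrow> K \<subseteq> F \<Longrightarrow> proper_on K \<phi>"
  unfolding proper_on_def by blast

lemma proper_on_inj_on: "proper_on F \<phi> \<Longrightarrow> inj_on \<phi> {e \<in> F. v \<in> e}"
  by (auto intro!: inj_onI dest: proper_onD)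

lemma card_colors_at: "proper_on F \<phi> \<Longrightarrow> card (\<phi> ` {e \<in> F. v \<in> e}) = edeg F v"
  by (simp add: card_image proper_on_inj_on edeg_def)

text \<open>Rename the colors along a bijection from \<open>{1..q}\<close> to \<open>S\<close>.
  Recolorings have to reuse the colors at hand, which need not be an initial segment.\<close>

lemma edge_colorable_into:
  assumes "edge_colorable F q" "finite S" "card S = q"
  obtains \<phi> where "\<phi> \<in> F \<rightarrow> S" "proper_on F \<phi>"
proof -
  obtain \<phi> where \<phi>: "\<phi> \<in> F \<rightarrow> {1..q}" "proper_on F \<phi>"
    using assms(1) unfolding edge_colorable_def by blast
  obtain h where h: "bij_betw h {1..q} S"
    using finite_same_card_bij[of "{1..q}" S] assms by auto
  have inj: "inj_on h {1..q}" and im: "h ` {1..q} = S" using h by (auto simp: bij_betw_def)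
  have "proper_on F (h \<circ> \<phi>)"
    unfolding proper_on_def
  proof (intro ballI impI)
    fix e e' assume *: "e \<in> F" "e' \<in> F" "e \<noteq> e' \<and> e \<inter> e' \<noteq> {}"
    then have "\<phi> e \<noteq> \<phi> e'" using \<phi>(2) unfolding proper_on_def by blast
    moreover have "\<phi> e \<in> {1..q}" "\<phi> e' \<in> {1..q}" using \<phi>(1) * by auto
    ultimately show "(h \<circ> \<phi>) e \<noteq> (h \<circ> \<phi>) e'" using inj by (auto dest: inj_onD)
  qed
  moreover have "h \<circ> \<phi> \<in> F \<rightarrow> S" using \<phi>(1) im by auto
  ultimately show ?thesis using that by blast
qed

lemma edeg_mono: "finite F \<Longrightarrow> K \<subseteq> F \<Longrightarrow> edeg K v \<le> edeg F v"
  unfolding edeg_def by (rule card_mono) auto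

lemma edeg_Diff: "finite F \<Longrightarrow> K \<subseteq> F \<Longrightarrow> edeg (F - K) v = edeg F v - edeg K v"
proof -
  assume "finite F" "K \<subseteq> F"
  moreover have "{e \<in> F - K. v \<in> e} = {e \<in> F. v \<in> e} - {e \<in> K. v \<in> e}" by auto
  ultimately show ?thesis unfolding edeg_def by (simp add: card_Diff_subset finite_subset Collect_mono_iff subset_iff)
qed

lemma edeg_matching:
  assumes "pairwise disjnt N"
  shows "edeg N v = (if v \<in> \<Union>N then 1 else 0)"
proof (cases "v \<in> \<Union>N")
  case True
  then obtain e where e: "e \<in> N" "v \<in> e" by auto
  have "{e \<in> N. v \<in> e} = {e}"
    using assms e by (auto simp: pairwise_def disjnt_iff)
  then show ?thesis using True by (simp add: edeg_def)
next
  case False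
  then have "{e \<in> N. v \<in> e} = {}" by auto
  then have "edeg N v = 0" unfolding edeg_def by (simp only: card.empty)
  then show ?thesis using False by simp
qed

lemma edeg_Diff_matching:
  assumes "finite F" "N \<subseteq> F" "pairwise disjnt N"
  shows "edeg (F - N) v = (if v \<in> \<Union>N then edeg F v - 1 else edeg F v)"
  using assms by (simp add: edeg_Diff edeg_matching)

lemma edeg_Diff_single:
  assumes "finite F" "r \<in> F"
  shows "edeg (F - {r}) v = (if v \<in> r then edeg F v - 1 else edeg F v)"
  using edeg_Diff_matching[of F "{r}"] assms by (simp add: pairwise_def)

lemma color_class_matching:
  "proper_on F \<phi> \<Longrightarrow> pairwise disjnt {e \<in> F. \<phi> e = c}"
  unfolding proper_on_def pairwise_def disjnt_def by blast

lemma edeg_le_card_colors: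
  assumes "proper_on F f" "finite S"
  shows "edeg {e \<in> F. f e \<in> S} v \<le> card S"
proof -
  have "proper_on {e \<in> F. f e \<in> S} f" by (rule proper_on_subset[OF assms(1)]) auto
  then have "edeg {e \<in> F. f e \<in> S} v = card (f ` {e \<in> {e \<in> F. f e \<in> S}. v \<in> e})"
    by (rule card_colors_at[symmetric])
  also have "\<dots> \<le> card S" using assms(2) by (intro card_mono) auto
  finally show ?thesis .
qed

text \<open>Otherwise the edges counted at \<open>v\<close> would have only the colors of
  \<open>S - {c}\<close>, too few for their number.\<close>

lemma edeg_full_color:
  assumes "proper_on F f" "finite S" "edeg {e \<in> F. f e \<in> S} v = card S" "c \<in> S"
  shows "\<exists>e\<in>F. v \<in> e \<and> f e = c"
proof (rule ccontr)
  assume "\<not> ?thesis"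
  then have "{e \<in> {e \<in> F. f e \<in> S}. v \<in> e} = {e \<in> {e \<in> F. f e \<in> S - {c}}. v \<in> e}" by auto
  then have "edeg {e \<in> F. f e \<in> S} v = edeg {e \<in> F. f e \<in> S - {c}} v" by (simp add: edeg_def)
  also have "\<dots> \<le> card (S - {c})" using assms by (intro edeg_le_card_colors) auto
  also have "\<dots> < card S" using assms by (meson card_Diff1_less)
  finally show False using assms by simp
qed

text \<open>A vertex that sees every color of \<open>S\<close> sees every color of
  \<open>S'\<close>, each on one edge. The main use is to pass from \<open>insert d S\<close> to
  \<open>S\<close>.\<close>

lemma edeg_full_subset:
  assumes "proper_on F f" "finite S" "S' \<subseteq> S" "edeg {e \<in> F. f e \<in> S} v = card S"
  shows "edeg {e \<in> F. f e \<in> S'} v = card S'"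
proof -
  have "proper_on {e \<in> F. f e \<in> S'} f" by (rule proper_on_subset[OF assms(1)]) auto
  then have "edeg {e \<in> F. f e \<in> S'} v = card (f ` {e \<in> {e \<in> F. f e \<in> S'}. v \<in> e})"
    by (rule card_colors_at[symmetric])
  moreover have "f ` {e \<in> {e \<in> F. f e \<in> S'}. v \<in> e} = S'"
  proof
    show "S' \<subseteq> f ` {e \<in> {e \<in> F. f e \<in> S'}. v \<in> e}"
    proof
      fix c assume "c \<in> S'"
      then obtain e where "e \<in> F" "v \<in> e" "f e = c"
        using edeg_full_color[OF assms(1,2,4)] assms(3) by blast
      then show "c \<in> f ` {e \<in> {e \<in> F. f e \<in> S'}. v \<in> e}" using \<open>c \<in> S'\<close> by auto
    qed
  qed auto
  ultimately show ?thesis by simp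
qed

section \<open>Matchings covering the vertices of large degree\<close>

text \<open>\<open>D\<close> is a color class of a \<open>q\<close>-coloring of \<open>K\<close>. A
  vertex \<open>w\<close> misses \<open>q - edeg K w\<close> colors, so the vertices of
  \<open>W\<close> together miss at most two, and \<open>q \<ge> 3\<close> leaves a color present at
  all of them. The other vertices to be covered have degree \<open>q\<close> in \<open>K\<close> and
  see every color.\<close>

lemma covering_color_class:
  assumes K: "K \<subseteq> F" and q: "q \<ge> 3"
    and col: "edge_colorable K q"
    and W: "finite W" "(\<Sum>w\<in>W. q - edeg K w) \<le> 2"
    and full: "\<And>v. edeg F v \<ge> q \<Longrightarrow> v \<notin> W \<Longrightarrow> edeg K v = q"
  shows "\<exists>D\<subseteq>F. pairwise disjnt D \<and> (\<forall>v. edeg F v \<ge> q \<longrightarrow> v \<in> \<Union>D)"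
proof -
  obtain \<phi> where \<phi>: "\<phi> \<in> K \<rightarrow> {1..q}" "proper_on K \<phi>"
    using col unfolding edge_colorable_def by blast
  define miss where "miss v = {1..q} - \<phi> ` {e \<in> K. v \<in> e}" for v
  have card_miss: "card (miss v) = q - edeg K v" for v
  proof -
    have "\<phi> ` {e \<in> K. v \<in> e} \<subseteq> {1..q}" using \<phi>(1) by auto
    then show ?thesis unfolding miss_def
      using card_Diff_subset[of "\<phi> ` {e \<in> K. v \<in> e}" "{1..q}"] card_colors_at[OF \<phi>(2), of v]
        finite_subset[of "\<phi> ` {e \<in> K. v \<in> e}" "{1..q}"] by simp
  qed
  have "card (\<Union>w\<in>W. miss w) \<le> (\<Sum>w\<in>W. card (miss w))" using W by (intro card_UN_le)
  also have "\<dots> \<le> 2" using W by (simp add: card_miss)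
  finally have "card (\<Union>w\<in>W. miss w) < card {1..q}" using q by simp
  then have "\<not> {1..q} \<subseteq> (\<Union>w\<in>W. miss w)"
    using W(1) by (metis (no_types, lifting) card_mono finite_UN_I finite_Diff finite_atLeastAtMost leD miss_def)
  then obtain \<gamma> where \<gamma>: "\<gamma> \<in> {1..q}" "\<gamma> \<notin> (\<Union>w\<in>W. miss w)" by blast
  define D where "D = {e \<in> K. \<phi> e = \<gamma>}"
  have "v \<in> \<Union>D" if "edeg F v \<ge> q" for v
  proof -
    have "\<gamma> \<notin> miss v"
    proof (cases "v \<in> W")
      case False
      then have "card (miss v) = 0" using full that card_miss by simp
      then have "miss v = {}" by (simp add: miss_def)
      then show ?thesis by simp
    qed (use \<gamma> in auto)
    then show ?thesis using \<gamma>(1) by (auto simp: miss_def D_def)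
  qed
  moreover have "D \<subseteq> F" using K by (auto simp: D_def)
  moreover have "pairwise disjnt D" unfolding D_def by (rule color_class_matching[OF \<phi>(2)])
  ultimately show ?thesis by blast
qed

lemma card_two_other:
  assumes "card e = 2" "x \<in> e"
  obtains w where "e = {x, w}" "w \<noteq> x"
  using assms by (auto simp: card_2_iff doubleton_eq_iff)

lemma edge_at: "0 < edeg F v \<Longrightarrow> \<exists>e\<in>F. v \<in> e"
  unfolding edeg_def by (auto simp: card_gt_0_iff)

text \<open>Let \<open>Y\<close> be the set of vertices of degree \<open>q + 1\<close>; it lies in
  \<open>X\<close>. Delete nothing if \<open>Y\<close> is empty, one edge if some edge contains
  \<open>Y\<close>, and otherwise one edge at each of the two vertices of \<open>Y\<close>. The rest
  has degree at most \<open>q\<close>, and the ends of deleted edges outside \<open>Y\<close>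
  together miss at most two colors.\<close>

lemma covering_matching:
  assumes fin: "finite F" and two: "\<And>e. e \<in> F \<Longrightarrow> card e = 2" and q: "q \<ge> 3"
    and col: "\<And>K. K \<subseteq> F \<Longrightarrow> (\<And>v. edeg K v \<le> q) \<Longrightarrow> edge_colorable K q"
    and X: "finite X" "card X \<le> 2"
    and deg: "\<And>v. edeg F v \<le> q + 1" "\<And>v. v \<notin> X \<Longrightarrow> edeg F v \<le> q"
  shows "\<exists>D\<subseteq>F. pairwise disjnt D \<and> (\<forall>v. edeg F v \<ge> q \<longrightarrow> v \<in> \<Union>D)"
proof -
  define Y where "Y = {v. edeg F v = q + 1}"
  have YX: "Y \<subseteq> X" using deg(2) by (force simp: Y_def)
  have finY: "finite Y" using YX X finite_subset by blast
  have cY: "card Y \<le> 2" using YX X card_mono le_trans by blast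
  have notY: "edeg F v \<le> q" if "v \<notin> Y" for v using that deg(1)[of v] by (auto simp: Y_def)
  have inY: "edeg F v = q + 1" if "v \<in> Y" for v using that by (simp add: Y_def)
  consider (none) "Y = {}" | (edge) r where "r \<in> F" "Y \<subseteq> r" "Y \<noteq> {}"
    | (two) x y where "Y = {x, y}" "x \<noteq> y" "\<And>r. r \<in> F \<Longrightarrow> \<not> Y \<subseteq> r"
  proof -
    have "card Y = 0 \<or> card Y = 1 \<or> card Y = 2" using cY by auto
    then show ?thesis
    proof (elim disjE)
      assume "card Y = 0" then show ?thesis using finY none by simp
    next
      assume "card Y = 1"
      then obtain x where x: "Y = {x}" using card_1_singletonE by blast
      then have "0 < edeg F x" using inY[of x] by simp
      then obtain r where "r \<in> F" "x \<in> r" using edge_at by metis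
      then show ?thesis using edge[of r] x by auto
    next
      assume "card Y = 2"
      then obtain x y where "Y = {x, y}" "x \<noteq> y" by (auto simp: card_2_iff)
      then show ?thesis using edge two by blast
    qed
  qed
  then show ?thesis
  proof cases
    case none
    show ?thesis
    proof (rule covering_color_class[OF _ q, of F F "{}"])
      show "edge_colorable F q" using none notY by (intro col) auto
    next
      fix v assume "q \<le> edeg F v" then show "edeg F v = q" using notY[of v] none by simp
    qed auto
  next
    case edge
    note d = edeg_Diff_single[OF fin edge(1)]
    define W where "W = {w \<in> r - Y. edeg F w \<ge> q}"
    have finr: "finite r" using two[OF edge(1)] card.infinite by force
    have "card (r - Y) < card r" using edge finr by (intro psubset_card_mono) auto
    moreover have "card W \<le> card (r - Y)" unfolding W_def using finr by (intro card_mono) auto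
    ultimately have cW: "card W \<le> 1" using two[OF edge(1)] by linarith
    have "edeg (F - {r}) w = q - 1" if "w \<in> W" for w
      using that notY[of w] by (auto simp: W_def d)
    then have "(\<Sum>w\<in>W. q - edeg (F - {r}) w) \<le> (\<Sum>w\<in>W. 1)" by (intro sum_mono) auto
    then have sW: "(\<Sum>w\<in>W. q - edeg (F - {r}) w) \<le> 2" using cW by simp
    show ?thesis
    proof (rule covering_color_class[OF _ q _ _ sW])
      show "edge_colorable (F - {r}) q"
      proof (intro col)
        fix v show "edeg (F - {r}) v \<le> q"
          using notY[of v] inY[of v] edge(2) by (cases "v \<in> Y") (auto simp: d)
      qed auto
      show "finite W" using finr by (simp add: W_def)
      fix v assume "q \<le> edeg F v" "v \<notin> W"
      then show "edeg (F - {r}) v = q"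
        using notY[of v] inY[of v] edge(2) by (cases "v \<in> Y") (auto simp: d W_def)
    qed auto
  next
    case two
    obtain r1 r2 where r: "r1 \<in> F" "x \<in> r1" "r2 \<in> F" "y \<in> r2"
      using edge_at[of F x] edge_at[of F y] inY[of x] inY[of y] two(1) by auto
    obtain w1 where w1: "r1 = {x, w1}" "w1 \<noteq> x"
      using card_two_other[OF assms(2)[OF r(1)] r(2)] by blast
    obtain w2 where w2: "r2 = {y, w2}" "w2 \<noteq> y"
      using card_two_other[OF assms(2)[OF r(3)] r(4)] by blast
    have wY: "w1 \<notin> Y" "w2 \<notin> Y" using two(3)[OF r(1)] two(3)[OF r(3)] two(1) w1 w2 by auto
    have r12: "r1 \<noteq> r2" using two(3)[OF r(1)] two(1) r by auto
    define K where "K = F - {r1} - {r2}"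
    have d: "edeg K v = edeg F v - (if v \<in> r1 then 1 else 0) - (if v \<in> r2 then 1 else 0)" for v
      using edeg_Diff_single[of "F - {r1}" r2 v] edeg_Diff_single[OF fin r(1), of v] fin r r12
      by (auto simp: K_def)
    have dY: "edeg K v = q" if "v \<in> Y" for v
      using that inY[of v] two(1,2) w1 w2 wY by (auto simp: d)
    define W where "W = {w \<in> {w1, w2}. edeg F w \<ge> q}"
    have Wq: "edeg F w = q" if "w \<in> W" for w using that notY[of w] wY by (auto simp: W_def)
    \<comment> \<open>The ends \<open>w1\<close> and \<open>w2\<close> may coincide; the two
      indicators then account for both colors missed at this vertex.\<close>
    have "(\<Sum>w\<in>W. q - edeg K w) \<le> (\<Sum>w\<in>W. (if w = w1 then 1 else 0) + (if w = w2 then 1 else 0))"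
    proof (rule sum_mono)
      fix w assume w: "w \<in> W"
      then have "w \<notin> Y" using wY by (auto simp: W_def)
      then have "w \<noteq> x" "w \<noteq> y" using two(1) by auto
      then show "q - edeg K w \<le> (if w = w1 then 1 else 0) + (if w = w2 then 1 else 0)"
        using Wq[OF w] w1 w2 q by (auto simp: d)
    qed
    also have "\<dots> \<le> 2" by (auto simp: W_def sum.distrib)
    finally have sW: "(\<Sum>w\<in>W. q - edeg K w) \<le> 2" .
    show ?thesis
    proof (rule covering_color_class[OF _ q _ _ sW])
      show "edge_colorable K q"
      proof (intro col)
        fix v show "edeg K v \<le> q"
          using notY[of v] dY[of v] by (cases "v \<in> Y") (auto simp: d)
      qed (auto simp: K_def)
      show "K \<subseteq> F" by (auto simp: K_def)
      show "finite W" by (simp add: W_def)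
      fix v assume v: "q \<le> edeg F v" "v \<notin> W"
      show "edeg K v = q"
      proof (cases "v \<in> Y")
        case False
        then have "v \<noteq> w1" "v \<noteq> w2" "v \<noteq> x" "v \<noteq> y" using v two(1) by (auto simp: W_def)
        then show ?thesis using notY[OF False] v w1 w2 by (simp add: d)
      qed (rule dY)
    qed
  qed
qed

section \<open>Recoloring\<close>

definition recolor_step :: "'a ugraph \<Rightarrow> nat \<Rightarrow> nat \<Rightarrow> ('a set \<Rightarrow> nat) \<Rightarrow> ('a set \<Rightarrow> nat) \<Rightarrow> bool" where
  "recolor_step G t n f g \<longleftrightarrow>
     proper_edge_coloring G t f \<and> proper_edge_coloring G t g \<and> differ_at_most G t n f g"

lemma proper_edge_coloring_iff:
  "proper_edge_coloring G t f \<longleftrightarrow> f \<in> uedges G \<rightarrow>\<^sub>E {1..t} \<and> proper_on (uedges G) f"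
  by (auto simp: proper_edge_coloring_def edge_coloring_def proper_on_def)

lemma recolor_stepI:
  assumes "proper_edge_coloring G t f" "proper_edge_coloring G t g"
    and "finite U" "card U \<le> n"
    and "\<And>e. e \<in> uedges G \<Longrightarrow> f e = g e \<or> f e \<in> U \<and> g e \<in> U"
  shows "recolor_step G t n f g"
proof -
  have "{j \<in> {1..t}. color_class G f j \<noteq> color_class G g j} \<subseteq> U"
    using assms(5) by (auto simp: color_class_def; metis)
  then have "card {j \<in> {1..t}. color_class G f j \<noteq> color_class G g j} \<le> card U"
    using assms(3) by (rule card_mono[rotated])
  then show ?thesis using assms by (auto simp: recolor_step_def differ_at_most_def)
qed

lemma n_equivalent_if_recolor_steps:
  assumes "(recolor_step G t n)\<^sup>*\<^sup>* f g" "proper_edge_coloring G t f"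
  shows "n_equivalent G t n f g"
proof -
  obtain k where "(recolor_step G t n ^^ k) f g" using assms(1) rtranclp_imp_relpowp by metis
  then obtain F where F: "F 0 = f" "F k = g" "\<And>i. i < k \<Longrightarrow> recolor_step G t n (F i) (F (Suc i))"
    unfolding relpowp_fun_conv by blast
  show ?thesis
  proof (cases "k = 0")
    case True
    then have "f = g" using F by simp
    \<comment> \<open>A sequence must have \<open>k \<ge> 1\<close>, so the empty chain becomes one
      constant step.\<close>
    then show ?thesis unfolding n_equivalent_def
      using assms(2) by (intro exI[of _ 1] exI[of _ "\<lambda>_. f"]) (simp add: differ_at_most_def)
  next
    case False
    have proper: "proper_edge_coloring G t (F i)" if "i \<le> k" for i
    proof (cases i)
      case 0 then show ?thesis using F assms by simp
    next
      case (Suc j) then show ?thesis using F(3)[of j] that by (simp add: recolor_step_def)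
    qed
    have diff: "differ_at_most G t n (F i) (F (i - 1))" if i: "i \<in> {1..k}" for i
    proof -
      have "recolor_step G t n (F (i - 1)) (F i)" using F(3)[of "i - 1"] i by (cases i) auto
      moreover have "{j \<in> {1..t}. color_class G (F i) j \<noteq> color_class G (F (i - 1)) j} =
          {j \<in> {1..t}. color_class G (F (i - 1)) j \<noteq> color_class G (F i) j}" by blast
      ultimately show ?thesis by (simp add: recolor_step_def differ_at_most_def)
    qed
    show ?thesis unfolding n_equivalent_def
      using False F proper diff by (intro exI[of _ k] exI[of _ F]) auto
  qed
qed

text \<open>No conflict arises between the two parts: edges of \<open>H\<close> receive colors in
  \<open>U\<close>, and the remaining edges keep colors outside \<open>U\<close>.\<close>

lemma recolor_part:
  assumes f: "proper_edge_coloring G t f" and U: "U \<subseteq> {1..t}" "card U \<le> n"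
    and H: "H = {e \<in> uedges G. f e \<in> U}"
    and \<psi>: "\<psi> \<in> H \<rightarrow> U" "proper_on H \<psi>"
    and f': "f' = (\<lambda>e. if e \<in> H then \<psi> e else f e)"
  shows "recolor_step G t n f f'"
proof (rule recolor_stepI[OF f])
  have pf: "f \<in> uedges G \<rightarrow>\<^sub>E {1..t}" "proper_on (uedges G) f" using f by (auto simp: proper_edge_coloring_iff)
  have "f' \<in> uedges G \<rightarrow>\<^sub>E {1..t}"
    using pf(1) \<psi>(1) U(1) by (auto simp: f' H PiE_def Pi_def extensional_def)
  moreover have "proper_on (uedges G) f'"
    unfolding proper_on_def
  proof (intro ballI impI)
    fix e e' assume e: "e \<in> uedges G" "e' \<in> uedges G" "e \<noteq> e' \<and> e \<inter> e' \<noteq> {}"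
    have "f e \<noteq> f e'" using e pf(2) by (auto simp: proper_on_def)
    moreover have "\<psi> e \<noteq> \<psi> e'" if "e \<in> H" "e' \<in> H" using that e \<psi>(2) by (auto simp: proper_on_def)
    moreover have "\<psi> e \<noteq> f e'" if "e \<in> H" "e' \<notin> H" using that e(2) \<psi>(1) by (auto simp: H Pi_def)
    moreover have "f e \<noteq> \<psi> e'" if "e \<notin> H" "e' \<in> H" using that e(1) \<psi>(1) by (auto simp: H Pi_def)
    ultimately show "f' e \<noteq> f' e'" by (simp add: f')
  qed
  ultimately show "proper_edge_coloring G t f'" by (simp add: proper_edge_coloring_iff)
  show "finite U" using U finite_subset by blast
  show "card U \<le> n" by fact
  show "f e = f' e \<or> f e \<in> U \<and> f' e \<in> U" if "e \<in> uedges G" for e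
    using that \<psi>(1) by (auto simp: f' H Pi_def)
qed

text \<open>For a proper \<open>f\<close>, degree \<open>card S\<close> in the
  \<open>S\<close>-colored edges means that all colors of \<open>S\<close> occur at the vertex. If
  \<open>X\<close> is empty, removing \<open>N\<close> therefore lowers the maximum degree below
  \<open>card S\<close>, provided \<open>S\<close> is finite and nonempty. The set \<open>X\<close>
  collects the vertices where this may fail.\<close>

definition covers_full :: "'a ugraph \<Rightarrow> nat set \<Rightarrow> ('a set \<Rightarrow> nat) \<Rightarrow> 'a set \<Rightarrow> 'a set set \<Rightarrow> bool" where
  "covers_full G S f X N \<longleftrightarrow>
     N \<subseteq> {e \<in> uedges G. f e \<in> S} \<and> pairwise disjnt N \<and>
     (\<forall>v. v \<notin> X \<and> edeg {e \<in> uedges G. f e \<in> S} v = card S \<longrightarrow> v \<in> \<Union>N)"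

section \<open>Moving a matching when all edge sets of maximum degree at most \<open>q\<close> are
  \<open>q\<close>-edge-colorable\<close>

locale sparse_colorable =
  fixes G :: "'a ugraph" and q t :: nat
  assumes fin: "finite (uedges G)"
    and card_edge: "\<And>e. e \<in> uedges G \<Longrightarrow> card e = 2"
    and q3: "q \<ge> 3"
    and colorable: "\<And>K. K \<subseteq> uedges G \<Longrightarrow> (\<And>v. edeg K v \<le> q) \<Longrightarrow> edge_colorable K q"
begin

text \<open>This returns from the \<open>q + 1\<close> colors \<open>insert d S\<close> to the
  \<open>q\<close> colors \<open>S\<close>. Outside \<open>X\<close> the graph \<open>H - N\<close>
  has degree at most \<open>q\<close>, so \<open>covering_matching\<close> gives a matching
  \<open>D\<close> disjoint from \<open>N\<close>. It becomes the class of \<open>d\<close>, and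
  \<open>N\<close> stays inside the edges colored from \<open>S\<close>.\<close>

lemma extract_color:
  assumes f: "proper_edge_coloring G t f"
    and S: "insert d S \<subseteq> {1..t}" "d \<notin> S" "card S = q"
    and N: "covers_full G (insert d S) f X N" and X: "finite X" "card X \<le> 2"
  obtains f' where "recolor_step G t (q + 1) f f'" "covers_full G S f' X N"
    "\<And>e. e \<in> uedges G \<Longrightarrow> f e = f' e \<or> f e \<in> insert d S \<and> f' e \<in> insert d S"
proof -
  define H where "H = {e \<in> uedges G. f e \<in> insert d S}"
  have pf: "proper_on (uedges G) f" using f by (simp add: proper_edge_coloring_iff)
  have finS: "finite S" using S finite_subset by (metis finite_insert finite_atLeastAtMost)
  have cU: "card (insert d S) = q + 1" using S finS by simp
  have HE: "H \<subseteq> uedges G" and finH: "finite H" using fin by (auto simp: H_def)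
  have NH: "N \<subseteq> H" and NM: "pairwise disjnt N"
    and Nfull: "\<And>v. v \<notin> X \<Longrightarrow> edeg H v = q + 1 \<Longrightarrow> v \<in> \<Union>N"
    using N cU by (auto simp: covers_full_def H_def)
  have degH: "edeg H v \<le> q + 1" for v
    using edeg_le_card_colors[OF pf, of "insert d S" v] finS cU by (simp add: H_def)
  have dHN: "edeg (H - N) v = (if v \<in> \<Union>N then edeg H v - 1 else edeg H v)" for v
    by (rule edeg_Diff_matching[OF finH NH NM])
  have "\<exists>D\<subseteq>H - N. pairwise disjnt D \<and> (\<forall>v. edeg (H - N) v \<ge> q \<longrightarrow> v \<in> \<Union>D)"
  proof (rule covering_matching[OF _ _ q3 _ X])
    show "edeg (H - N) v \<le> q + 1" for v using degH[of v] by (auto simp: dHN)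
    show "edeg (H - N) v \<le> q" if "v \<notin> X" for v
      using degH[of v] Nfull[OF that] by (cases "edeg H v = q + 1") (auto simp: dHN)
    show "edge_colorable K q" if "K \<subseteq> H - N" "\<And>v. edeg K v \<le> q" for K
      using that HE by (intro colorable) auto
    show "card e = 2" if "e \<in> H - N" for e using that HE card_edge by auto
  qed (use finH in auto)
  then obtain D where D: "D \<subseteq> H - N" "pairwise disjnt D" "\<And>v. edeg (H - N) v \<ge> q \<Longrightarrow> v \<in> \<Union>D"
    by blast
  have DH: "D \<subseteq> H" using D by auto
  have dHD: "edeg (H - D) v = (if v \<in> \<Union>D then edeg H v - 1 else edeg H v)" for v
    by (rule edeg_Diff_matching[OF finH DH D(2)])
  have "edge_colorable (H - D) q"
  proof (rule colorable)
    show "H - D \<subseteq> uedges G" using HE by auto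
    fix v show "edeg (H - D) v \<le> q"
    proof (cases "edeg H v = q + 1")
      case True
      \<comment> \<open>The matching \<open>N\<close> takes at most one edge from \<open>v\<close>,
        which leaves degree at least \<open>q\<close> in \<open>H - N\<close>.\<close>
      then have "v \<in> \<Union>D" by (intro D(3)) (simp add: dHN)
      then show ?thesis using True by (simp only: dHD) simp
    qed (use degH[of v] in \<open>auto simp: dHD\<close>)
  qed
  then obtain \<psi> where \<psi>: "\<psi> \<in> H - D \<rightarrow> S" "proper_on (H - D) \<psi>"
    using edge_colorable_into finS S(3) by metis
  define \<psi>' where "\<psi>' e = (if e \<in> D then d else \<psi> e)" for e
  define f' where "f' = (\<lambda>e. if e \<in> H then \<psi>' e else f e)"
  have \<psi>': "\<psi>' \<in> H \<rightarrow> insert d S" using \<psi>(1) by (auto simp: \<psi>'_def Pi_def)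
  have "proper_on H \<psi>'"
    unfolding proper_on_def
  proof (intro ballI impI)
    fix e e' assume e: "e \<in> H" "e' \<in> H" "e \<noteq> e' \<and> e \<inter> e' \<noteq> {}"
    have "\<not> (e \<in> D \<and> e' \<in> D)" using e D(2) by (auto simp: pairwise_def disjnt_def)
    moreover have "\<psi> e \<in> S" if "e \<notin> D" using that \<psi>(1) e by auto
    moreover have "\<psi> e' \<in> S" if "e' \<notin> D" using that \<psi>(1) e by auto
    moreover have "\<psi> e \<noteq> \<psi> e'" if "e \<notin> D" "e' \<notin> D" using that \<psi>(2) e by (auto simp: proper_on_def)
    ultimately show "\<psi>' e \<noteq> \<psi>' e'" using S(2) by (auto simp: \<psi>'_def)
  qed
  then have st: "recolor_step G t (q + 1) f f'"
    using recolor_part[OF f S(1) _ H_def \<psi>' _ f'_def] cU by simp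
  have HS: "{e \<in> uedges G. f' e \<in> S} = H - D"
    using \<psi>(1) HE S(2) by (auto simp: f'_def \<psi>'_def H_def Pi_def)
  \<comment> \<open>If \<open>N\<close> missed such a vertex, its degree in \<open>H - N\<close>
    would be at least \<open>q\<close>, so \<open>D\<close> would cover it. Its degree in
    \<open>H\<close> would then be \<open>q + 1\<close>, and \<open>N\<close> covers such vertices
    outside \<open>X\<close>.\<close>
  have "v \<in> \<Union>N" if v: "v \<notin> X" "edeg (H - D) v = q" for v
  proof (rule ccontr)
    assume n: "v \<notin> \<Union>N"
    have "q \<le> edeg H v" using v(2) edeg_mono[OF finH, of "H - D" v] by auto
    then have "v \<in> \<Union>D" using n by (intro D(3)) (simp only: dHN if_False)
    then have "edeg H v = q + 1" using v(2) q3 dHD[of v] by (simp del: Union_iff)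
    then show False using Nfull[OF v(1)] n by blast
  qed
  then have cf: "covers_full G S f' X N"
    unfolding covers_full_def HS using NH NM D(1) S(3) by blast
  have "f e = f' e \<or> f e \<in> insert d S \<and> f' e \<in> insert d S" if "e \<in> uedges G" for e
    using that \<psi>' by (auto simp: f'_def H_def Pi_def)
  then show ?thesis using that st cf by blast
qed

text \<open>With no exceptional vertices \<open>N\<close> covers every vertex of degree
  \<open>q + 1\<close>, so the rest of the \<open>U\<close>-colored edges can be colored with
  \<open>U - {c}\<close>, leaving \<open>c\<close> for \<open>N\<close>.\<close>

lemma set_color_class:
  assumes f: "proper_edge_coloring G t f"
    and S: "U \<subseteq> {1..t}" "card U = q + 1" "c \<in> U"
    and N: "covers_full G U f {} N"
  obtains f' where "recolor_step G t (q + 1) f f'" "{e \<in> uedges G. f' e = c} = N"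
    "\<And>e. e \<in> uedges G \<Longrightarrow> f e = f' e \<or> f e \<in> U \<and> f' e \<in> U"
proof -
  define H where "H = {e \<in> uedges G. f e \<in> U}"
  have pf: "proper_on (uedges G) f" using f by (simp add: proper_edge_coloring_iff)
  have finU: "finite U" using S finite_subset by blast
  have HE: "H \<subseteq> uedges G" and finH: "finite H" using fin by (auto simp: H_def)
  have NH: "N \<subseteq> H" and NM: "pairwise disjnt N"
    and Nfull: "\<And>v. edeg H v = q + 1 \<Longrightarrow> v \<in> \<Union>N"
    using N S(2) by (auto simp: covers_full_def H_def)
  have degH: "edeg H v \<le> q + 1" for v
    using edeg_le_card_colors[OF pf finU, of v] S by (simp add: H_def)
  have "edge_colorable (H - N) q"
  proof (rule colorable)
    show "H - N \<subseteq> uedges G" using HE by auto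
    fix v show "edeg (H - N) v \<le> q"
      using degH[of v] Nfull[of v] edeg_Diff_matching[OF finH NH NM, of v]
      by (cases "edeg H v = q + 1") (auto split: if_splits)
  qed
  then obtain \<psi> where \<psi>: "\<psi> \<in> H - N \<rightarrow> U - {c}" "proper_on (H - N) \<psi>"
    using edge_colorable_into[of "H - N" q "U - {c}"] finU S by auto
  define \<psi>' where "\<psi>' e = (if e \<in> N then c else \<psi> e)" for e
  define f' where "f' = (\<lambda>e. if e \<in> H then \<psi>' e else f e)"
  have \<psi>': "\<psi>' \<in> H \<rightarrow> U" using \<psi>(1) S(3) by (auto simp: \<psi>'_def)
  have "proper_on H \<psi>'"
    unfolding proper_on_def
  proof (intro ballI impI)
    fix e e' assume e: "e \<in> H" "e' \<in> H" "e \<noteq> e' \<and> e \<inter> e' \<noteq> {}"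
    have "\<not> (e \<in> N \<and> e' \<in> N)" using e NM by (auto simp: pairwise_def disjnt_def)
    moreover have "\<psi> e \<noteq> c" if "e \<notin> N" using that \<psi>(1) e by auto
    moreover have "\<psi> e' \<noteq> c" if "e' \<notin> N" using that \<psi>(1) e by auto
    moreover have "\<psi> e \<noteq> \<psi> e'" if "e \<notin> N" "e' \<notin> N" using that \<psi>(2) e by (auto simp: proper_on_def)
    ultimately show "\<psi>' e \<noteq> \<psi>' e'" by (auto simp: \<psi>'_def)
  qed
  then have st: "recolor_step G t (q + 1) f f'"
    using recolor_part[OF f S(1) _ H_def \<psi>' _ f'_def] S(2) by simp
  have cl: "{e \<in> uedges G. f' e = c} = N"
    using \<psi>(1) HE NH S(3) by (auto simp: f'_def \<psi>'_def H_def Pi_def)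
  have "f e = f' e \<or> f e \<in> U \<and> f' e \<in> U" if "e \<in> uedges G" for e
    using that \<psi>' by (auto simp: f'_def H_def Pi_def)
  then show ?thesis using that st cl by blast
qed

lemma swap_in_edge:
  assumes f: "proper_on (uedges G) f" and S: "finite S" "d \<notin> S"
    and N: "covers_full G S f X N"
    and m: "m \<in> uedges G" "f m \<in> insert d S"
  defines "N' \<equiv> insert m {e \<in> N. e \<inter> m = {}}"
  shows "covers_full G (insert d S) f (X - m \<union> (\<Union>{e \<in> N. e \<inter> m \<noteq> {}} - m)) N'"
proof -
  have full: "edeg {e \<in> uedges G. f e \<in> S} v = card S"
    if "edeg {e \<in> uedges G. f e \<in> insert d S} v = card (insert d S)" for v
    using edeg_full_subset[OF f _ _ that, of S] S by auto
  have NM: "pairwise disjnt N" using N by (simp add: covers_full_def)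
  then have "pairwise disjnt N'"
    by (auto simp: N'_def pairwise_def disjnt_def Int_commute)
  moreover have "N' \<subseteq> {e \<in> uedges G. f e \<in> insert d S}"
    using N m by (auto simp: N'_def covers_full_def)
  moreover have "v \<in> \<Union>N'"
    if out: "v \<notin> X - m \<union> (\<Union>{e \<in> N. e \<inter> m \<noteq> {}} - m)"
      and dv: "edeg {e \<in> uedges G. f e \<in> insert d S} v = card (insert d S)" for v
  proof (cases "v \<in> m")
    case False
    then have "v \<notin> X" using out by auto
    then obtain e where "e \<in> N" "v \<in> e"
      using N full[OF dv] by (auto simp: covers_full_def)
    then show ?thesis using out False by (auto simp: N'_def)
  qed (auto simp: N'_def)
  ultimately show ?thesis unfolding covers_full_def by blast
qed

text \<open>Each end of \<open>m\<close> covered by \<open>N\<close> lies on a single edge of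
  \<open>N\<close>, which has at most one end off \<open>m\<close>.\<close>

lemma card_displaced:
  assumes N: "N \<subseteq> uedges G" "pairwise disjnt N" and m: "m \<in> uedges G"
  shows "card (\<Union>{e \<in> N. e \<inter> m \<noteq> {}} - m) \<le> card (m \<inter> \<Union>N)"
proof -
  have finm: "finite m" using card_edge[OF m] card.infinite by force
  have "card (\<Union>{e \<in> N. u \<in> e} - m) \<le> 1" if u: "u \<in> m \<inter> \<Union>N" for u
  proof -
    obtain e where e: "e \<in> N" "u \<in> e" using u by auto
    have "{e \<in> N. u \<in> e} = {e}" using N(2) e by (auto simp: pairwise_def disjnt_iff)
    then have *: "\<Union>{e \<in> N. u \<in> e} - m = e - m" by simp
    have ce: "card e = 2" using e N(1) card_edge by auto
    then have "finite e" using card.infinite by force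
    then have "card (e - m) \<le> card (e - {u})" using u by (intro card_mono) auto
    then show ?thesis using e ce * by simp
  qed
  then have "(\<Sum>u\<in>m \<inter> \<Union>N. card (\<Union>{e \<in> N. u \<in> e} - m)) \<le> (\<Sum>u\<in>m \<inter> \<Union>N. 1)"
    by (intro sum_mono)
  moreover have "card (\<Union>u\<in>m \<inter> \<Union>N. \<Union>{e \<in> N. u \<in> e} - m) \<le>
      (\<Sum>u\<in>m \<inter> \<Union>N. card (\<Union>{e \<in> N. u \<in> e} - m))"
    using finm by (intro card_UN_le) auto
  moreover have "\<Union>{e \<in> N. e \<inter> m \<noteq> {}} - m = (\<Union>u\<in>m \<inter> \<Union>N. \<Union>{e \<in> N. u \<in> e} - m)"
    by auto
  ultimately show ?thesis by simp
qed

text \<open>The factor 3 in the measure makes one edge of the symmetric difference outweigh the at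
  most two vertices of the new exceptional set, whether an edge of \<open>M\<close> is added or one
  outside \<open>M\<close> is dropped. As long as \<open>X\<close> is nonempty, one of its vertices
  is treated first: it is covered by \<open>N\<close>, or lies on an edge of \<open>M\<close>, or
  misses a color of \<open>T\<close> by \<open>free\<close>.\<close>

lemma reach_matching:
  assumes T: "T \<subseteq> {1..t}" and S: "S \<subset> T" "card S = q"
    and M: "M \<subseteq> uedges G" "pairwise disjnt M"
    and f: "proper_edge_coloring G t f"
    and MT: "\<And>e. e \<in> M \<Longrightarrow> f e \<in> T"
    and free: "\<And>v. v \<notin> \<Union>M \<Longrightarrow> edeg {e \<in> uedges G. f e \<in> T} v < card T"
    and N: "covers_full G S f X N" and X: "finite X" "card X \<le> 2"
  shows "\<exists>f'. (recolor_step G t (q + 1))\<^sup>*\<^sup>* f f' \<and> proper_edge_coloring G t f' \<and>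
    covers_full G S f' {} M \<and> (\<forall>e\<in>uedges G. f e = f' e \<or> f e \<in> T \<and> f' e \<in> T)"
  using f MT free N X
proof (induction "3 * card (M - N \<union> (N - M)) + card X" arbitrary: f N X rule: less_induct)
  case less
  note f = less.prems(1) and MT = less.prems(2) and free = less.prems(3)
    and N = less.prems(4) and X = less.prems(5,6)
  have pf: "proper_on (uedges G) f" using f by (simp add: proper_edge_coloring_iff)
  have finT: "finite T" using T finite_subset by blast
  have finS: "finite S" using S(1) finT finite_subset by blast
  have NE: "N \<subseteq> uedges G" and NM: "pairwise disjnt N" using N by (auto simp: covers_full_def)
  have finMN: "finite (M - N \<union> (N - M))" using M NE fin finite_subset by blast
  \<comment> \<open>One round: extract the color \<open>d\<close>, then apply the induction
    hypothesis. The set of \<open>T\<close>-colored edges does not change, so \<open>MT\<close> and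
    \<open>free\<close> survive.\<close>
  have go: ?case
    if d: "d \<in> T" "d \<notin> S" and N': "covers_full G (insert d S) f X' N'"
      and X': "finite X'" "card X' \<le> 2"
      and lt: "3 * card (M - N' \<union> (N' - M)) + card X' < 3 * card (M - N \<union> (N - M)) + card X"
    for d X' N'
  proof -
    have U: "insert d S \<subseteq> {1..t}" "insert d S \<subseteq> T" using d S T by auto
    obtain f1 where f1: "recolor_step G t (q + 1) f f1" "covers_full G S f1 X' N'"
      "\<And>e. e \<in> uedges G \<Longrightarrow> f e = f1 e \<or> f e \<in> insert d S \<and> f1 e \<in> insert d S"
      using extract_color[OF f U(1) d(2) S(2) N' X'] by blast
    have f1T: "f e = f1 e \<or> f e \<in> T \<and> f1 e \<in> T" if "e \<in> uedges G" for e
      using f1(3)[OF that] U(2) by auto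
    have HT: "{e \<in> uedges G. f1 e \<in> T} = {e \<in> uedges G. f e \<in> T}" using f1T by metis
    have "proper_edge_coloring G t f1" using f1(1) by (simp add: recolor_step_def)
    moreover have "f1 e \<in> T" if "e \<in> M" for e using f1T[of e] MT[OF that] subsetD[OF M(1) that] by auto
    ultimately obtain f' where "(recolor_step G t (q + 1))\<^sup>*\<^sup>* f1 f'" "proper_edge_coloring G t f'"
      "covers_full G S f' {} M" "\<forall>e\<in>uedges G. f1 e = f' e \<or> f1 e \<in> T \<and> f' e \<in> T"
      using less.hyps[OF lt, of f1] free f1(2) X' HT by auto
    moreover have "(recolor_step G t (q + 1))\<^sup>*\<^sup>* f f'"
      using f1(1) calculation(1) by (rule converse_rtranclp_into_rtranclp)
    ultimately show ?thesis using f1T by metis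
  qed
  have add: ?case
    if m: "m \<in> M" "m \<notin> N" and X': "card (X - m \<union> (\<Union>{e \<in> N. e \<inter> m \<noteq> {}} - m)) \<le> 2" for m
  proof -
    define N' where "N' = insert m {e \<in> N. e \<inter> m = {}}"
    define X' where "X' = X - m \<union> (\<Union>{e \<in> N. e \<inter> m \<noteq> {}} - m)"
    \<comment> \<open>If \<open>f m\<close> lies in \<open>S\<close>, any color of
      \<open>T - S\<close> serves; otherwise \<open>d\<close> is \<open>f m\<close> itself.\<close>
    obtain d where d: "d \<in> T" "d \<notin> S" "f m \<in> insert d S"
      using MT[OF m(1)] S(1) by (cases "f m \<in> S") auto
    have mE: "m \<in> uedges G" using m M by auto
    have fe: "finite e" if "e \<in> uedges G" for e using card_edge[OF that] card.infinite by force
    have "finite X'" using X(1) NE fin fe unfolding X'_def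
      by (intro finite_UnI finite_Diff finite_Union) (auto intro: finite_subset)
    moreover have "covers_full G (insert d S) f X' N'"
      unfolding X'_def N'_def by (rule swap_in_edge[OF pf finS d(2) N mE d(3)])
    moreover have "3 * card (M - N' \<union> (N' - M)) + card X' < 3 * card (M - N \<union> (N - M)) + card X"
    proof -
      \<comment> \<open>The displaced edges meet the edge \<open>m\<close> of the matching
        \<open>M\<close> and differ from it, so removing them does not enlarge the symmetric
        difference.\<close>
      have dis: "e \<notin> M" if "e \<in> N" "e \<inter> m \<noteq> {}" for e
        using that m M(2) by (metis pairwiseD disjnt_def)
      have "M - N' \<union> (N' - M) \<subset> M - N \<union> (N - M)"
      proof
        show "M - N' \<union> (N' - M) \<subseteq> M - N \<union> (N - M)" using m(1) dis by (auto simp: N'_def)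
        have "m \<in> M - N \<union> (N - M)" "m \<notin> M - N' \<union> (N' - M)" using m by (auto simp: N'_def)
        then show "M - N' \<union> (N' - M) \<noteq> M - N \<union> (N - M)" by metis
      qed
      then have "card (M - N' \<union> (N' - M)) < card (M - N \<union> (N - M))"
        using finMN by (rule psubset_card_mono[rotated])
      then show ?thesis using X' unfolding X'_def by linarith
    qed
    ultimately show ?thesis using go[OF d(1,2)] X' by (simp add: X'_def)
  qed
  have NU: "covers_full G (insert d S) f X' N'"
    if "d \<notin> S" "N' \<subseteq> N" "\<And>v. v \<notin> X' \<Longrightarrow>
        edeg {e \<in> uedges G. f e \<in> insert d S} v = card (insert d S) \<Longrightarrow> v \<in> X \<or> v \<in> \<Union>N \<Longrightarrow> v \<in> \<Union>N'"
    for d N' X'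
  proof -
    have "edeg {e \<in> uedges G. f e \<in> S} v = card S"
      if "edeg {e \<in> uedges G. f e \<in> insert d S} v = card (insert d S)" for v
      using edeg_full_subset[OF pf _ _ that, of S] finS by auto
    moreover have "pairwise disjnt N'" using NM that(2) by (rule pairwise_subset)
    moreover have "N' \<subseteq> {e \<in> uedges G. f e \<in> insert d S}" using N that(2) by (auto simp: covers_full_def)
    ultimately show ?thesis using N that(3) unfolding covers_full_def by blast
  qed
  obtain d0 where d0: "d0 \<in> T" "d0 \<notin> S" using S(1) by auto
  show ?case
  proof (cases "X = {}")
    case Xe: True
    consider "N = M" | m where "m \<in> M" "m \<notin> N" | e where "e \<in> N" "e \<notin> M" by blast
    then show ?thesis
    proof cases
      case 1
      then show ?thesis using N Xe f by blast
    next
      case 2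
      have mE: "m \<in> uedges G" using 2 M by auto
      have finm: "finite m" using card_edge[OF mE] card.infinite by force
      have "card (\<Union>{e \<in> N. e \<inter> m \<noteq> {}} - m) \<le> card (m \<inter> \<Union>N)" by (rule card_displaced[OF NE NM mE])
      also have "\<dots> \<le> card m" using finm by (intro card_mono) auto
      finally show ?thesis using add[OF 2] Xe card_edge[OF mE] by simp
    next
      case 3
      have ce: "card e = 2" using 3 NE card_edge by auto
      have "card (M - (N - {e}) \<union> ((N - {e}) - M)) < card (M - N \<union> (N - M))"
        using finMN 3 by (intro psubset_card_mono) auto
      then have "3 * card (M - (N - {e}) \<union> ((N - {e}) - M)) + card e < 3 * card (M - N \<union> (N - M)) + card X"
        using ce by linarith
      moreover have "covers_full G (insert d0 S) f e (N - {e})"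
        using Xe by (intro NU d0) auto
      moreover have "finite e" using ce card.infinite by force
      ultimately show ?thesis using go[OF d0] ce by simp
    qed
  next
    case False
    then obtain x where x: "x \<in> X" by auto
    have cX: "card (X - {x}) < card X" using X x by (meson card_Diff1_less)
    then have cX1: "card (X - {x}) \<le> 1" using X by linarith
    have lt: "3 * card (M - N \<union> (N - M)) + card (X - {x}) < 3 * card (M - N \<union> (N - M)) + card X"
      using cX by simp
    have drop: ?thesis if "covers_full G S f (X - {x}) N"
      using less.hyps[OF lt f MT free that] X cX1 by simp
    consider "x \<in> \<Union>N" | m where "x \<notin> \<Union>N" "m \<in> M" "x \<in> m" | "x \<notin> \<Union>N" "x \<notin> \<Union>M" by blast
    then show ?thesis
    proof cases
      case 1
      then show ?thesis using N by (intro drop) (auto simp: covers_full_def)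
    next
      case 2
      have mE: "m \<in> uedges G" using 2 M by auto
      have finm: "finite m" using card_edge[OF mE] card.infinite by force
      have "card (\<Union>{e \<in> N. e \<inter> m \<noteq> {}} - m) \<le> card (m \<inter> \<Union>N)" by (rule card_displaced[OF NE NM mE])
      \<comment> \<open>As \<open>N\<close> misses \<open>x\<close>, only the other end of
        \<open>m\<close> can displace an edge. So at most one vertex joins the at most one vertex
        left in \<open>X - m\<close>.\<close>
      also have "\<dots> \<le> card (m - {x})" using finm 2 by (intro card_mono) auto
      finally have "card (\<Union>{e \<in> N. e \<inter> m \<noteq> {}} - m) \<le> 1" using card_edge[OF mE] 2 finm by simp
      moreover have "card (X - m) \<le> card (X - {x})" using X(1) 2 by (intro card_mono) auto
      ultimately have "card (X - m \<union> (\<Union>{e \<in> N. e \<inter> m \<noteq> {}} - m)) \<le> 2"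
        using card_Un_le[of "X - m" "\<Union>{e \<in> N. e \<inter> m \<noteq> {}} - m"] cX1 by linarith
      then show ?thesis using add[of m] 2 by auto
    next
      case 3
      \<comment> \<open>A color \<open>d\<close> missing at \<open>x\<close> keeps \<open>x\<close>
        from being full for every color set that contains \<open>d\<close>. Hence \<open>x\<close>
        leaves \<open>X\<close>: at once if \<open>d\<close> is in \<open>S\<close>, and by
        extracting \<open>d\<close> otherwise.\<close>
      have "\<exists>d\<in>T. \<forall>e\<in>uedges G. x \<in> e \<longrightarrow> f e \<noteq> d"
      proof (rule ccontr)
        assume "\<not> ?thesis"
        then have "\<exists>e\<in>uedges G. x \<in> e \<and> f e = c" if "c \<in> T" for c using that by auto
        then have "T \<subseteq> f ` {e \<in> {e \<in> uedges G. f e \<in> T}. x \<in> e}" by fastforce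
        then have "card T \<le> card (f ` {e \<in> {e \<in> uedges G. f e \<in> T}. x \<in> e})"
          using fin by (intro card_mono) auto
        also have "\<dots> = edeg {e \<in> uedges G. f e \<in> T} x"
          by (rule card_colors_at) (rule proper_on_subset[OF pf], auto)
        finally show False using free[OF 3(2)] by simp
      qed
      then obtain d where d: "d \<in> T" "\<And>e. e \<in> uedges G \<Longrightarrow> x \<in> e \<Longrightarrow> f e \<noteq> d" by blast
      have nf: "edeg {e \<in> uedges G. f e \<in> U} x \<noteq> card U" if "d \<in> U" "finite U" for U
        using edeg_full_color[OF pf that(2) _ that(1)] d(2) by metis
      show ?thesis
      proof (cases "d \<in> S")
        case True
        then show ?thesis using N nf[OF True finS]
          by (intro drop) (auto simp: covers_full_def)
      next
        case dS: False
        have "covers_full G (insert d S) f (X - {x}) N"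
          using N nf[of "insert d S"] finS edeg_full_subset[OF pf, of "insert d S" S]
          by (auto simp: covers_full_def)
        then show ?thesis using go[OF d(1) dS _ _ _ lt] X cX1 by simp
      qed
    qed
  qed
qed

text \<open>\<open>T\<close> holds the colors whose classes may still differ. Each round gives one
  color \<open>c\<close> of \<open>T\<close> the class it has under \<open>g\<close> and removes
  \<open>c\<close> from \<open>T\<close>; once at most \<open>q + 1\<close> colors remain, a single
  step finishes.\<close>

lemma recolor_between:
  assumes "T \<subseteq> {1..t}" "proper_edge_coloring G t f" "proper_edge_coloring G t g"
    and "\<And>e. e \<in> uedges G \<Longrightarrow> f e = g e \<or> f e \<in> T \<and> g e \<in> T"
  shows "(recolor_step G t (q + 1))\<^sup>*\<^sup>* f g"
  using assms
proof (induction "card T" arbitrary: T f rule: less_induct)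
  case less
  note T = less.prems(1) and f = less.prems(2) and g = less.prems(3) and fg = less.prems(4)
  have finT: "finite T" using T finite_subset by blast
  show ?case
  proof (cases "card T \<le> q + 1")
    case True
    then show ?thesis using recolor_stepI[OF f g finT _ fg] by blast
  next
    case False
    then obtain U where U: "U \<subseteq> T" "card U = q + 1" using obtain_subset_with_card_n[of "q + 1" T] by auto
    have finU: "finite U" using U finT finite_subset by blast
    obtain c where c: "c \<in> U" using U(2) by fastforce
    \<comment> \<open>Removing \<open>d\<close> from \<open>U\<close> leaves a set \<open>S\<close>
      of \<open>q\<close> colors that still contains \<open>c\<close>.\<close>
    obtain d where d: "d \<in> U" "d \<noteq> c"
    proof -
      have "card (U - {c}) > 0" using U(2) c finU q3 by simp
      then show ?thesis using that by (force simp: card_gt_0_iff)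
    qed
    define S where "S = U - {d}"
    have S: "S \<subset> T" "card S = q" "c \<in> S" "insert d S = U" "d \<notin> S" "finite S"
      using U d c finU by (auto simp: S_def)
    define M where "M = {e \<in> uedges G. g e = c}"
    have pf: "proper_on (uedges G) f" and pg: "proper_on (uedges G) g"
      using f g by (auto simp: proper_edge_coloring_iff)
    have M: "M \<subseteq> uedges G" "pairwise disjnt M"
      using color_class_matching[OF pg] by (auto simp: M_def)
    have cT: "c \<in> T" using U c by auto
    have HT: "{e \<in> uedges G. f e \<in> T} = {e \<in> uedges G. g e \<in> T}" using fg by metis
    have MT: "f e \<in> T" if "e \<in> M" for e using that fg[of e] cT by (auto simp: M_def)
    have free: "edeg {e \<in> uedges G. f e \<in> T} v < card T" if "v \<notin> \<Union>M" for v
    proof -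
      have "edeg {e \<in> uedges G. g e \<in> T} v \<noteq> card T"
        using edeg_full_color[OF pg finT _ cT, of v] that by (auto simp: M_def)
      moreover have "edeg {e \<in> uedges G. g e \<in> T} v \<le> card T" by (rule edeg_le_card_colors[OF pg finT])
      ultimately show ?thesis unfolding HT by simp
    qed
    \<comment> \<open>The starting matching is the class of \<open>c\<close> under \<open>f\<close>:
      a vertex that sees all of \<open>S\<close> sees \<open>c\<close>.\<close>
    have "covers_full G S f {} {e \<in> uedges G. f e = c}"
      using color_class_matching[OF pf] edeg_full_color[OF pf S(6) _ S(3)] S(3)
      unfolding covers_full_def by auto
    then obtain f1 where f1: "(recolor_step G t (q + 1))\<^sup>*\<^sup>* f f1" "proper_edge_coloring G t f1"
      "covers_full G S f1 {} M" "\<And>e. e \<in> uedges G \<Longrightarrow> f e = f1 e \<or> f e \<in> T \<and> f1 e \<in> T"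
      using reach_matching[OF T S(1,2) M f MT free] by fastforce
    have pf1: "proper_on (uedges G) f1" using f1 by (simp add: proper_edge_coloring_iff)
    \<comment> \<open>Vertices full for \<open>U\<close> are full for \<open>S\<close>, so
      \<open>M\<close> covers them and can be made the class of \<open>c\<close> within
      \<open>U\<close>.\<close>
    have "covers_full G U f1 {} M"
      using f1(3) edeg_full_subset[OF pf1 finU, of S] S(4)
      unfolding covers_full_def by blast
    then obtain f2 where f2: "recolor_step G t (q + 1) f1 f2" "{e \<in> uedges G. f2 e = c} = M"
      "\<And>e. e \<in> uedges G \<Longrightarrow> f1 e = f2 e \<or> f1 e \<in> U \<and> f2 e \<in> U"
      using set_color_class[OF f1(2) _ U(2) c] U(1) T by blast
    have "(recolor_step G t (q + 1))\<^sup>*\<^sup>* f2 g"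
    proof (rule less.hyps[of "T - {c}"])
      show "card (T - {c}) < card T" using finT cT by (meson card_Diff1_less)
      show "T - {c} \<subseteq> {1..t}" using T by auto
      show "proper_edge_coloring G t f2" using f2(1) by (simp add: recolor_step_def)
      show "proper_edge_coloring G t g" by fact
      fix e assume e: "e \<in> uedges G"
      have "f2 e = c \<longleftrightarrow> g e = c" using f2(2) e by (auto simp: M_def)
      moreover have "f2 e = g e \<or> f2 e \<in> T \<and> g e \<in> T"
        using fg[OF e] f1(4)[OF e] f2(3)[OF e] U(1) by auto
      ultimately show "f2 e = g e \<or> f2 e \<in> T - {c} \<and> g e \<in> T - {c}" by auto
    qed
    then show ?thesis using f1(1) f2(1) by (meson converse_rtranclp_into_rtranclp rtranclp_trans)
  qed
qed

end

section \<open>Edge colorings of bipartite graphs\<close>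

text \<open>Induct on the edges. With \<open>\<alpha>\<close> missing at one end \<open>x\<close> of
  the new edge and \<open>\<beta>\<close> at the other end \<open>y\<close>, exchanging both colors
  along the chain at \<open>x\<close> frees \<open>\<beta>\<close> at both ends.\<close>

lemma koenig_edge_coloring:
  assumes "finite F" and "X \<inter> Y = {}"
    and "\<And>e. e \<in> F \<Longrightarrow> \<exists>x\<in>X. \<exists>y\<in>Y. e = {x, y}"
    and "\<And>v. edeg F v \<le> q"
  shows "edge_colorable F q"
  using assms(1,3,4)
proof (induction F rule: finite_induct)
  case empty
  then show ?case by (simp add: edge_colorable_def proper_on_def)
next
  case (insert e F)
  note bip = insert.prems(1)
  have "edge_colorable F q"
  proof (rule insert.IH)
    show "edeg F v \<le> q" for v
      using order_trans[OF edeg_mono insert.prems(2)[of v]] insert.hyps(1) by blast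
  qed (use insert.prems(1) in auto)
  then obtain \<phi> where \<phi>: "\<phi> \<in> F \<rightarrow> {1..q}" "proper_on F \<phi>"
    unfolding edge_colorable_def by blast
  obtain x y where e: "e = {x, y}" and xX: "x \<in> X" and yY: "y \<in> Y" using bip by blast
  \<comment> \<open>Without \<open>e\<close>, each end of \<open>e\<close> has degree below
    \<open>q\<close>, so a color is missing there.\<close>
  have free: "\<exists>c\<in>{1..q}. \<forall>e'\<in>F. v \<in> e' \<longrightarrow> \<phi> e' \<noteq> c" if "v \<in> e" for v
  proof (rule ccontr)
    assume "\<not> ?thesis"
    then have "\<exists>e'\<in>F. v \<in> e' \<and> \<phi> e' = c" if "c \<in> {1..q}" for c using that by blast
    then have "{1..q} \<subseteq> \<phi> ` {e' \<in> F. v \<in> e'}" by (fastforce simp del: atLeastAtMost_iff)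
    then have "card {1..q} \<le> card (\<phi> ` {e' \<in> F. v \<in> e'})"
      using insert.hyps(1) by (intro card_mono) auto
    then have "q \<le> edeg F v" by (simp add: card_colors_at[OF \<phi>(2)])
    moreover have "edeg F v = edeg (insert e F) v - 1"
      using edeg_Diff_single[of "insert e F" e v] insert.hyps that by simp
    moreover have "edeg (insert e F) v > 0"
      using that insert.hyps(1) by (auto simp: edeg_def card_gt_0_iff)
    ultimately show False using insert.prems(2)[of v] by simp
  qed
  obtain \<alpha> where \<alpha>: "\<alpha> \<in> {1..q}" "\<And>e'. e' \<in> F \<Longrightarrow> x \<in> e' \<Longrightarrow> \<phi> e' \<noteq> \<alpha>"
    using free[of x] e by auto
  obtain \<beta> where \<beta>: "\<beta> \<in> {1..q}" "\<And>e'. e' \<in> F \<Longrightarrow> y \<in> e' \<Longrightarrow> \<phi> e' \<noteq> \<beta>"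
    using free[of y] e by auto
  \<comment> \<open>The Kempe chain at \<open>x\<close>, traversed so that it leaves \<open>X\<close> only along \<open>\<beta>\<close> and \<open>Y\<close> only along
    \<open>\<alpha>\<close>; hence it cannot enter \<open>y\<close>, which misses \<open>\<beta>\<close>.\<close>
  define r where "r = {(u, w). {u, w} \<in> F \<and> (u \<in> X \<and> \<phi> {u, w} = \<beta> \<or> u \<in> Y \<and> \<phi> {u, w} = \<alpha>)}"
  define R where "R = r\<^sup>* `` {x}"
  have xR: "x \<in> R" by (simp add: R_def)
  have stepR: "w \<in> R" if "u \<in> R" "(u, w) \<in> r" for u w using that by (auto simp: R_def)
  have last: "\<exists>u\<in>R. (u, w) \<in> r" if "w \<in> R" "w \<noteq> x" for w
  proof -
    have "(x, w) \<in> r\<^sup>*" using that by (simp add: R_def)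
    then show ?thesis using that(2) by (cases rule: rtranclE) (auto simp: R_def)
  qed
  have sides: "(u \<in> X \<and> w \<in> Y \<or> u \<in> Y \<and> w \<in> X)" if "{u, w} \<in> F" for u w
  proof -
    have "{u, w} \<in> insert e F" using that by simp
    then obtain a b where "a \<in> X" "b \<in> Y" "{u, w} = {a, b}" using bip by blast
    then show ?thesis by (auto simp: doubleton_eq_iff)
  qed
  have lastX: "\<exists>w\<in>R. {u, w} \<in> F \<and> \<phi> {u, w} = \<alpha>" if uR: "u \<in> R" "u \<noteq> x" and uX: "u \<in> X" for u
  proof -
    obtain w where w: "w \<in> R" "(w, u) \<in> r" using last[OF uR] by blast
    then have "{w, u} \<in> F" by (auto simp: r_def)
    then have "w \<in> Y" using sides uX assms(2) by blast
    then have "\<phi> {w, u} = \<alpha>" using w(2) assms(2) by (auto simp: r_def)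
    then show ?thesis using w \<open>{w, u} \<in> F\<close> by (auto simp: insert_commute)
  qed
  have lastY: "\<exists>u\<in>R. {u, w} \<in> F \<and> \<phi> {u, w} = \<beta>" if wR: "w \<in> R" and wY: "w \<in> Y" for w
  proof -
    have "w \<noteq> x" using wY xX assms(2) by auto
    then obtain u where u: "u \<in> R" "(u, w) \<in> r" using last[OF wR] by blast
    then have "{u, w} \<in> F" by (auto simp: r_def)
    then have "u \<in> X" using sides wY assms(2) by blast
    then have "\<phi> {u, w} = \<beta>" using u(2) assms(2) by (auto simp: r_def)
    then show ?thesis using u \<open>{u, w} \<in> F\<close> by auto
  qed
  have yR: "y \<notin> R" using lastY[of y] \<beta>(2) yY by blast
  \<comment> \<open>One of the two colors leads out of a vertex of \<open>R\<close> along
    \<open>r\<close>. An edge of the other color is the one through which the vertex was entered, by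
    properness; \<open>x\<close> was not entered but misses \<open>\<alpha>\<close>.\<close>
  have closed: "e' \<subseteq> R" if e': "e' \<in> F" "\<phi> e' = \<alpha> \<or> \<phi> e' = \<beta>" "e' \<inter> R \<noteq> {}" for e'
  proof -
    have "e' \<in> insert e F" using e' by simp
    then obtain u w where uw: "u \<in> X" "w \<in> Y" "e' = {u, w}" using bip by blast
    have "w \<in> R" if u: "u \<in> R"
    proof (cases "\<phi> e' = \<beta>")
      case True
      then show ?thesis using stepR[OF u] uw e'(1) by (auto simp: r_def)
    next
      case False
      then have a: "\<phi> e' = \<alpha>" using e'(2) by simp
      then have "u \<noteq> x" using \<alpha>(2)[OF e'(1)] uw by auto
      then obtain w' where w': "w' \<in> R" "{u, w'} \<in> F" "\<phi> {u, w'} = \<alpha>" using lastX u uw by blast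
      then have "e' = {u, w'}" using proper_onD[OF \<phi>(2) e'(1), of "{u, w'}" u] uw a by auto
      then show ?thesis using w' uw by (auto simp: doubleton_eq_iff)
    qed
    moreover have "u \<in> R" if w: "w \<in> R"
    proof (cases "\<phi> e' = \<alpha>")
      case True
      then show ?thesis using stepR[OF w, of u] uw e'(1) by (auto simp: r_def insert_commute)
    next
      case False
      then have a: "\<phi> e' = \<beta>" using e'(2) by simp
      then obtain u' where u': "u' \<in> R" "{u', w} \<in> F" "\<phi> {u', w} = \<beta>" using lastY w uw by blast
      then have "e' = {u', w}" using proper_onD[OF \<phi>(2) e'(1), of "{u', w}" w] uw a by auto
      then show ?thesis using u' uw by (auto simp: doubleton_eq_iff)
    qed
    ultimately show ?thesis using e'(3) uw by auto
  qed
  define sw where "sw c = (if c = \<alpha> then \<beta> else if c = \<beta> then \<alpha> else c)" for c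
  define \<phi>' where "\<phi>' e' = (if e' = e then \<beta> else if e' \<inter> R \<noteq> {} then sw (\<phi> e') else \<phi> e')" for e'
  have sw_eq: "sw c = sw c' \<longleftrightarrow> c = c'" for c c' by (auto simp: sw_def)
  have range: "\<phi>' \<in> insert e F \<rightarrow> {1..q}"
    using \<phi>(1) \<alpha>(1) \<beta>(1) by (auto simp: \<phi>'_def sw_def Pi_def)
  \<comment> \<open>At \<open>x\<close> the exchange turns \<open>\<beta>\<close> into
    \<open>\<alpha>\<close>, and no edge there had \<open>\<alpha>\<close>. At \<open>y\<close>,
    outside \<open>R\<close>, an \<open>\<alpha>\<close>-edge does not meet \<open>R\<close> by
    \<open>closed\<close> and keeps its color.\<close>
  have new: "\<phi>' e' \<noteq> \<beta>" if e': "e' \<in> F" "e \<inter> e' \<noteq> {}" for e'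
  proof -
    have ne: "e' \<noteq> e" using e' insert.hyps by auto
    consider "x \<in> e'" | "y \<in> e'" using e' e by auto
    then show ?thesis
    proof cases
      case 1
      then show ?thesis using xR \<alpha>(2)[OF e'(1)] ne by (auto simp: \<phi>'_def sw_def)
    next
      case 2
      then have "\<not> e' \<subseteq> R" using yR by auto
      then show ?thesis using \<beta>(2)[OF e'(1) 2] closed[OF e'(1)] ne by (auto simp: \<phi>'_def sw_def)
    qed
  qed
  have old: "\<phi>' e1 \<noteq> \<phi>' e2" if h: "e1 \<in> F" "e2 \<in> F" "e1 \<noteq> e2" "e1 \<inter> e2 \<noteq> {}" for e1 e2
  proof -
    have n: "\<phi> e1 \<noteq> \<phi> e2" "e1 \<noteq> e" "e2 \<noteq> e"
      using h \<phi>(2) insert.hyps by (auto simp: proper_on_def)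
    \<comment> \<open>Such an edge meets \<open>R\<close> without lying inside it, so
      \<open>closed\<close> excludes both exchanged colors.\<close>
    have mixed: "sw (\<phi> a) = \<phi> a" if "a \<in> F" "a \<inter> R \<noteq> {}" "b \<inter> R = {}" "a \<inter> b \<noteq> {}" for a b
    proof -
      have "\<not> a \<subseteq> R" using that by auto
      then show ?thesis using closed[OF that(1)] that(2) by (auto simp: sw_def)
    qed
    show ?thesis using n mixed[of e1 e2] mixed[of e2 e1] h
      by (auto simp: \<phi>'_def sw_eq Int_commute)
  qed
  have "proper_on (insert e F) \<phi>'"
    unfolding proper_on_def
  proof (intro ballI impI)
    fix e1 e2 assume h: "e1 \<in> insert e F" "e2 \<in> insert e F" "e1 \<noteq> e2 \<and> e1 \<inter> e2 \<noteq> {}"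
    have "\<phi>' e = \<beta>" by (simp add: \<phi>'_def)
    then show "\<phi>' e1 \<noteq> \<phi>' e2" using h old[of e1 e2] new[of e1] new[of e2] by (metis Int_commute insert_iff)
  qed
  then show ?case using range unfolding edge_colorable_def by blast
qed

section \<open>Gluing along cutvertices\<close>

text \<open>Permute the colors on \<open>E2\<close> so that the set \<open>B\<close> of those at
  \<open>v\<close> moves to a set \<open>C\<close> disjoint from the colors \<open>A\<close> used at
  \<open>v\<close> by \<open>E1\<close>. The degree bound at \<open>v\<close> leaves room for
  \<open>C\<close>, and conflicts between the parts can occur only at \<open>v\<close>.\<close>

lemma edge_colorable_glue:
  assumes fin: "finite E1" "finite E2" and disj: "E1 \<inter> E2 = {}"
    and meet: "\<And>e1 e2. e1 \<in> E1 \<Longrightarrow> e2 \<in> E2 \<Longrightarrow> e1 \<inter> e2 \<subseteq> {v}"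
    and deg: "edeg (E1 \<union> E2) v \<le> q"
    and col: "edge_colorable E1 q" "edge_colorable E2 q"
  shows "edge_colorable (E1 \<union> E2) q"
proof -
  obtain \<phi> where \<phi>: "\<phi> \<in> E1 \<rightarrow> {1..q}" "proper_on E1 \<phi>"
    using col(1) unfolding edge_colorable_def by blast
  obtain \<psi> where \<psi>: "\<psi> \<in> E2 \<rightarrow> {1..q}" "proper_on E2 \<psi>"
    using col(2) unfolding edge_colorable_def by blast
  define A where "A = \<phi> ` {e \<in> E1. v \<in> e}"
  define B where "B = \<psi> ` {e \<in> E2. v \<in> e}"
  have AB: "A \<subseteq> {1..q}" "B \<subseteq> {1..q}" using \<phi>(1) \<psi>(1) by (auto simp: A_def B_def)
  then have finAB: "finite A" "finite B" using finite_subset by blast+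
  have "{e \<in> E1 \<union> E2. v \<in> e} = {e \<in> E1. v \<in> e} \<union> {e \<in> E2. v \<in> e}" by auto
  then have "edeg (E1 \<union> E2) v = edeg E1 v + edeg E2 v"
    using fin disj unfolding edeg_def by (simp add: card_Un_disjoint disjoint_iff)
  then have "card A + card B \<le> q"
    using deg card_colors_at[OF \<phi>(2), of v] card_colors_at[OF \<psi>(2), of v] by (simp add: A_def B_def)
  then have "card B \<le> card ({1..q} - A)" using AB finAB by (simp add: card_Diff_subset)
  then obtain C where C: "C \<subseteq> {1..q} - A" "card C = card B"
    using obtain_subset_with_card_n[of "card B" "{1..q} - A"] by auto
  have finC: "finite C" using C finite_subset by blast
  obtain h1 where h1: "bij_betw h1 B C" using finite_same_card_bij finAB finC C by metis
  have "card ({1..q} - B) = card ({1..q} - C)"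
    using AB finAB finC C by (subst (1 2) card_Diff_subset) auto
  then obtain h2 where h2: "bij_betw h2 ({1..q} - B) ({1..q} - C)"
    using finite_same_card_bij[of "{1..q} - B" "{1..q} - C"] by auto
  define h where "h c = (if c \<in> B then h1 c else h2 c)" for c
  have hB: "bij_betw h B C" using h1 by (simp add: h_def cong: bij_betw_cong)
  moreover have "bij_betw h ({1..q} - B) ({1..q} - C)"
    using h2 bij_betw_cong[of "{1..q} - B" h h2] by (simp add: h_def)
  ultimately have hb: "bij_betw h (B \<union> ({1..q} - B)) (C \<union> ({1..q} - C))"
    by (rule bij_betw_combine) auto
  have hBC: "h ` B = C" using hB by (simp add: bij_betw_def)
  have "B \<union> ({1..q} - B) = {1..q}" "C \<union> ({1..q} - C) = {1..q}" using AB C by auto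
  then have hinj: "inj_on h {1..q}" and him: "h ` {1..q} = {1..q}" using hb by (auto simp: bij_betw_def)
  define \<chi> where "\<chi> e = (if e \<in> E1 then \<phi> e else h (\<psi> e))" for e
  have "\<chi> \<in> E1 \<union> E2 \<rightarrow> {1..q}" using \<phi>(1) \<psi>(1) him by (auto simp: \<chi>_def Pi_def)
  moreover have "proper_on (E1 \<union> E2) \<chi>"
  proof -
    have a: "\<phi> e1 \<noteq> h (\<psi> e2)" if "e1 \<in> E1" "e2 \<in> E2" "e1 \<inter> e2 \<noteq> {}" for e1 e2
    proof -
      have "v \<in> e1" "v \<in> e2" using meet that by blast+
      then have "\<phi> e1 \<in> A" "h (\<psi> e2) \<in> C" using that hBC by (auto simp: A_def B_def)
      then show ?thesis using C by auto
    qed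
    have b: "h (\<psi> e1) \<noteq> h (\<psi> e2)" if "e1 \<in> E2" "e2 \<in> E2" "e1 \<noteq> e2" "e1 \<inter> e2 \<noteq> {}" for e1 e2
    proof -
      have "\<psi> e1 \<noteq> \<psi> e2" using that \<psi>(2) by (auto simp: proper_on_def)
      then show ?thesis using that \<psi>(1) hinj by (auto dest!: inj_onD simp: Pi_def)
    qed
    show ?thesis
      unfolding proper_on_def
    proof (intro ballI impI)
      fix e1 e2 assume h: "e1 \<in> E1 \<union> E2" "e2 \<in> E1 \<union> E2" "e1 \<noteq> e2 \<and> e1 \<inter> e2 \<noteq> {}"
      then show "\<chi> e1 \<noteq> \<chi> e2"
        using a[of e1 e2] a[of e2 e1] b[of e1 e2] \<phi>(2) by (auto simp: \<chi>_def proper_on_def Int_commute)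
    qed
  qed
  ultimately show ?thesis unfolding edge_colorable_def by blast
qed

section \<open>Cutvertices and blocks\<close>

lemma subgraph_of_trans: "subgraph_of A B \<Longrightarrow> subgraph_of B C \<Longrightarrow> subgraph_of A C"
  by (auto simp: subgraph_of_def)

lemma finite_uedges: "fin_simple_graph G \<Longrightarrow> finite (uedges G)"
  unfolding fin_simple_graph_def by (meson PowI finite_Pow_iff finite_subset subsetI)

lemma joined_edge:
  assumes "(u, a) \<in> joined G" "{a, b} \<in> uedges G" "b \<in> uverts G"
  shows "(u, b) \<in> joined G"
  using assms by (auto simp: joined_def intro: rtrancl_into_rtrancl)

lemma joined_refl: "u \<in> uverts G \<Longrightarrow> (u, u) \<in> joined G"
  by (simp add: joined_def)

text \<open>If the remaining vertices were pairwise joined, deleting \<open>v\<close> would leave at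
  most one component, no more than \<open>G\<close> has.\<close>

lemma cutvertex_not_joined:
  assumes "finite (uverts G)" "cutvertex G v"
  shows "\<exists>u\<in>uverts G - {v}. \<exists>w\<in>uverts G - {v}. (u, w) \<notin> joined (delete_vertex G v)"
proof (rule ccontr)
  assume "\<not> ?thesis"
  then have all: "(u, w) \<in> joined (delete_vertex G v)" if "u \<in> uverts G - {v}" "w \<in> uverts G - {v}" for u w
    using that by blast
  have sub: "joined (delete_vertex G v) `` {u} \<subseteq> uverts G - {v}" for u
    by (auto simp: joined_def delete_vertex_def)
  have "joined (delete_vertex G v) `` {u} = uverts G - {v}" if "u \<in> uverts G - {v}" for u
    using sub[of u] all[OF that] by blast
  then have "graph_components (delete_vertex G v) \<subseteq> {uverts G - {v}}"
    by (auto simp: graph_components_def quotient_def delete_vertex_def)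
  then have "card (graph_components (delete_vertex G v)) \<le> 1"
    using card_mono[of "{uverts G - {v}}"] by fastforce
  moreover have "graph_components G \<noteq> {}" "finite (graph_components G)"
    using assms by (auto simp: graph_components_def quotient_def cutvertex_def)
  then have "card (graph_components G) \<ge> 1" by (simp add: Suc_leI card_gt_0_iff)
  ultimately show False using assms(2) by (simp add: cutvertex_def)
qed

text \<open>Split at a cutvertex, or into a component and the rest, and glue colorings of the two
  smaller parts. The hypothesis speaks of all connected subgraphs without cutvertex, not only of
  blocks, so that it passes to the parts.\<close>

lemma edge_colorable_if_nonseparable:
  assumes "fin_simple_graph H" and "\<And>v. edeg (uedges H) v \<le> q"
    and "\<And>B. subgraph_of B H \<Longrightarrow> connected_graph B \<Longrightarrow> \<nexists>v. cutvertex B v \<Longrightarrow> edge_colorable (uedges B) q"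
  shows "edge_colorable (uedges H) q"
  using assms
proof (induction "card (uverts H)" arbitrary: H rule: less_induct)
  case less
  note H = less.prems(1)
  have finV: "finite (uverts H)" and two: "\<And>e. e \<in> uedges H \<Longrightarrow> card e = 2"
    and eV: "\<And>e. e \<in> uedges H \<Longrightarrow> e \<subseteq> uverts H"
    using H by (auto simp: fin_simple_graph_def)
  have finE: "finite (uedges H)" by (rule finite_uedges[OF H])
  have self: "subgraph_of H H" using H by (simp add: subgraph_of_def)
  have split: ?case
    if V: "V1 \<subset> uverts H" "V2 \<subset> uverts H" "V1 \<inter> V2 \<subseteq> {v}"
      and E: "\<And>e. e \<in> uedges H \<Longrightarrow> e \<subseteq> V1 \<or> e \<subseteq> V2" for V1 V2 v
  proof -
    have sub: "edge_colorable {e \<in> uedges H. e \<subseteq> W} q" if W: "W \<subset> uverts H" for W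
    proof -
      let ?K = "\<lparr>uverts = W, uedges = {e \<in> uedges H. e \<subseteq> W}\<rparr>"
      have K: "fin_simple_graph ?K" using W finV two by (auto simp: fin_simple_graph_def intro: finite_subset)
      have KH: "subgraph_of ?K H" using K W by (auto simp: subgraph_of_def)
      have "edge_colorable (uedges ?K) q"
      proof (rule less.hyps[OF _ K])
        show "card (uverts ?K) < card (uverts H)" using W finV by (simp add: psubset_card_mono)
        show "edeg (uedges ?K) v \<le> q" for v
          using less.prems(2)[of v] edeg_mono[OF finE, of "uedges ?K" v] by auto
        show "edge_colorable (uedges B) q"
          if "subgraph_of B ?K" "connected_graph B" "\<nexists>v. cutvertex B v" for B
          using less.prems(3) subgraph_of_trans[OF that(1) KH] that by blast
      qed
      then show ?thesis by simp
    qed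
    have un: "{e \<in> uedges H. e \<subseteq> V1} \<union> {e \<in> uedges H. e \<subseteq> V2} = uedges H" using E by auto
    have "edge_colorable ({e \<in> uedges H. e \<subseteq> V1} \<union> {e \<in> uedges H. e \<subseteq> V2}) q"
    proof (rule edge_colorable_glue[of _ _ v])
      show "{e \<in> uedges H. e \<subseteq> V1} \<inter> {e \<in> uedges H. e \<subseteq> V2} = {}"
      proof (rule ccontr)
        assume "\<not> ?thesis"
        then obtain e where e: "e \<in> uedges H" "e \<subseteq> {v}" using V(3) by blast
        then have "card e \<le> 1" using card_mono[of "{v}" e] by simp
        then show False using two[OF e(1)] by simp
      qed
      show "edeg ({e \<in> uedges H. e \<subseteq> V1} \<union> {e \<in> uedges H. e \<subseteq> V2}) v \<le> q"
        unfolding un by (rule less.prems(2))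
    qed (use finE V sub in auto)
    then show ?thesis unfolding un .
  qed
  show ?case
  proof (cases "connected_graph H")
    case False
    show ?thesis
    proof (cases "uverts H = {}")
      case True
      then have "uedges H = {}" using eV two by fastforce
      then show ?thesis by (simp add: edge_colorable_def proper_on_def)
    next
      case ne: False
      then obtain u w where uw: "u \<in> uverts H" "w \<in> uverts H" "(u, w) \<notin> joined H"
        using False by (auto simp: connected_graph_def)
      define C where "C = {z \<in> uverts H. (u, z) \<in> joined H}"
      have "e \<subseteq> C \<or> e \<subseteq> uverts H - C" if e: "e \<in> uedges H" for e
      proof -
        obtain a b where ab: "e = {a, b}" using two[OF e] by (auto simp: card_2_iff)
        then have "a \<in> C \<longleftrightarrow> b \<in> C"
          using joined_edge[of u a H b] joined_edge[of u b H a] e eV[OF e] by (auto simp: C_def insert_commute)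
        then show ?thesis using ab eV[OF e] by auto
      qed
      \<comment> \<open>The two sides are disjoint here, so any vertex can play the role of the
        common vertex.\<close>
      then show ?thesis
        using uw joined_refl[OF uw(1)] by (intro split[of C "uverts H - C"]) (auto simp: C_def)
    qed
  next
    case True
    show ?thesis
    proof (cases "\<exists>v. cutvertex H v")
      case False
      then show ?thesis using less.prems(3)[OF self True] by blast
    next
      case cut: True
      then obtain v where v: "cutvertex H v" by blast
      let ?D = "delete_vertex H v"
      obtain u w where uw: "u \<in> uverts H - {v}" "w \<in> uverts H - {v}" "(u, w) \<notin> joined ?D"
        using cutvertex_not_joined[OF finV v] by blast
      define C where "C = {z \<in> uverts ?D. (u, z) \<in> joined ?D}"
      have CV: "C \<subseteq> uverts H - {v}" by (auto simp: C_def delete_vertex_def)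
      have vV: "v \<in> uverts H" using v by (simp add: cutvertex_def)
      have uC: "u \<in> C" "w \<notin> C" using uw joined_refl[of u ?D] by (auto simp: C_def delete_vertex_def)
      \<comment> \<open>\<open>C\<close> is the component of \<open>u\<close> in
        \<open>H - v\<close>, and \<open>v\<close> belongs to both sides. The vertex
        \<open>w\<close> is absent from the first side and \<open>u\<close> from the second, so both
        are smaller than \<open>H\<close>.\<close>
      have "e \<subseteq> insert v C \<or> e \<subseteq> uverts H - C" if e: "e \<in> uedges H" for e
      proof (cases "v \<in> e")
        case True
        then obtain b where "e = {v, b}" using card_two_other[OF two[OF e]] by metis
        then show ?thesis using eV[OF e] CV vV by auto
      next
        case False
        obtain a b where ab: "e = {a, b}" using two[OF e] by (auto simp: card_2_iff)
        have "{a, b} \<in> uedges ?D" "a \<in> uverts ?D" "b \<in> uverts ?D"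
          using False e ab eV[OF e] by (auto simp: delete_vertex_def)
        then have "a \<in> C \<longleftrightarrow> b \<in> C"
          using joined_edge[of u a ?D b] joined_edge[of u b ?D a] by (auto simp: C_def insert_commute)
        then show ?thesis using ab eV[OF e] by auto
      qed
      moreover have "insert v C \<subset> uverts H" using CV vV uw uC by auto
      moreover have "uverts H - C \<subset> uverts H" using uw uC by auto
      moreover have "insert v C \<inter> (uverts H - C) \<subseteq> {v}" by auto
      ultimately show ?thesis using split by metis
    qed
  qed
qed

text \<open>Among the connected subgraphs without cutvertex that contain \<open>B\<close>, take one
  with the largest total number of vertices and edges.\<close>

lemma nonseparable_in_block:
  assumes "fin_simple_graph G" "subgraph_of B G" "connected_graph B" "\<nexists>v. cutvertex B v"
  obtains B' where "block_of B' G" "subgraph_of B B'"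
proof -
  define P where "P B' \<longleftrightarrow> subgraph_of B' G \<and> connected_graph B' \<and> (\<nexists>v. cutvertex B' v) \<and> subgraph_of B B'" for B'
  define size where "size K = card (uverts K) + card (uedges K)" for K :: "'a ugraph"
  have finG: "finite (uverts G)" "finite (uedges G)"
    using assms(1) finite_uedges by (auto simp: fin_simple_graph_def)
  have "P B" using assms by (auto simp: P_def subgraph_of_def)
  moreover have "size K < card (uverts G) + card (uedges G) + 1" if "P K" for K
  proof -
    have "uverts K \<subseteq> uverts G" "uedges K \<subseteq> uedges G" using that by (auto simp: P_def subgraph_of_def)
    then have "card (uverts K) \<le> card (uverts G)" "card (uedges K) \<le> card (uedges G)"
      using finG by (auto intro: card_mono)
    then show ?thesis by (simp add: size_def)
  qed
  ultimately obtain B' where B': "P B'" "\<And>K. P K \<Longrightarrow> size K \<le> size B'"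
    using ex_has_greatest_nat[of P B size] by (metis less_imp_le)
  have "K = B'" if K: "subgraph_of K G" "connected_graph K" "\<nexists>v. cutvertex K v" "subgraph_of B' K" for K
  proof -
    have "P K" using K B'(1) subgraph_of_trans by (auto simp: P_def)
    then have le: "size K \<le> size B'" by (rule B'(2))
    have sub: "uverts B' \<subseteq> uverts K" "uedges B' \<subseteq> uedges K" using K(4) by (auto simp: subgraph_of_def)
    have fK: "finite (uverts K)" "finite (uedges K)"
      using K(1) finG by (auto simp: subgraph_of_def intro: finite_subset)
    have "card (uverts B') \<le> card (uverts K)" "card (uedges B') \<le> card (uedges K)"
      using sub fK by (auto intro: card_mono)
    then have "card (uverts B') = card (uverts K)" "card (uedges B') = card (uedges K)"
      using le by (auto simp: size_def)
    then have "uverts B' = uverts K" "uedges B' = uedges K"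
      using sub fK card_subset_eq by blast+
    then show ?thesis by simp
  qed
  then have "block_of B' G" using B'(1) by (auto simp: block_of_def P_def)
  then show ?thesis using that B'(1) by (auto simp: P_def)
qed

section \<open>The hypothesis on blocks in terms of edge sets\<close>

lemma max_degree_le_iff:
  assumes "fin_simple_graph G"
  shows "max_degree G \<le> q \<longleftrightarrow> (\<forall>v. edeg (uedges G) v \<le> q)"
proof -
  have "edeg (uedges G) v = 0" if "v \<notin> uverts G" for v
  proof -
    have "{e \<in> uedges G. v \<in> e} = {}" using assms that by (auto simp: fin_simple_graph_def)
    then show ?thesis unfolding edeg_def by (simp only: card.empty)
  qed
  moreover have "vertex_degree G v = edeg (uedges G) v" for v
    by (simp add: vertex_degree_def edeg_def)
  moreover have "max_degree G \<le> q \<longleftrightarrow> (\<forall>v\<in>uverts G. vertex_degree G v \<le> q)"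
    using assms by (simp add: max_degree_def fin_simple_graph_def)
  ultimately show ?thesis by (metis le0)
qed

text \<open>Every connected subgraph without cutvertex of the graph with edge set \<open>K\<close>
  lies in a block of \<open>G\<close>, where either Koenig's theorem or membership in A(q) colors
  it.\<close>

lemma edge_colorable_if_blocks:
  assumes G: "fin_simple_graph G"
    and blocks: "\<And>B. block_of B G \<Longrightarrow> bipartite_graph B \<or> B \<in> class_A q"
    and K: "K \<subseteq> uedges G" "\<And>v. edeg K v \<le> q"
  shows "edge_colorable K q"
proof -
  let ?H = "\<lparr>uverts = uverts G, uedges = K\<rparr>"
  have H: "fin_simple_graph ?H" using G K(1) by (auto simp: fin_simple_graph_def)
  have HG: "subgraph_of ?H G" using H K(1) by (simp add: subgraph_of_def)
  have finK: "finite K" using K(1) finite_uedges[OF G] finite_subset by blast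
  have "edge_colorable (uedges ?H) q"
  proof (rule edge_colorable_if_nonseparable[OF H])
    fix B assume B: "subgraph_of B ?H" "connected_graph B" "\<nexists>v. cutvertex B v"
    obtain B' where B': "block_of B' G" "subgraph_of B B'"
      using nonseparable_in_block[OF G subgraph_of_trans[OF B(1) HG] B(2,3)] by blast
    have simple: "fin_simple_graph B" and BK: "uedges B \<subseteq> K" using B(1) by (auto simp: subgraph_of_def)
    have deg: "edeg (uedges B) v \<le> q" for v using edeg_mono[OF finK BK, of v] K(2)[of v] by simp
    consider "bipartite_graph B'" | "B' \<in> class_A q" using blocks[OF B'(1)] by blast
    then show "edge_colorable (uedges B) q"
    proof cases
      case 1
      then obtain X Y where "X \<inter> Y = {}" "\<forall>e\<in>uedges B'. \<exists>x\<in>X. \<exists>y\<in>Y. e = {x, y}"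
        by (auto simp: bipartite_graph_def)
      moreover have "uedges B \<subseteq> uedges B'" using B'(2) by (simp add: subgraph_of_def)
      ultimately show ?thesis
        using finite_uedges[OF simple] deg by (intro koenig_edge_coloring[of _ X Y]) auto
    next
      case 2
      then obtain \<phi> where "proper_edge_coloring B q \<phi>"
        using B'(2) deg max_degree_le_iff[OF simple] by (auto simp: class_A_def)
      then show ?thesis by (auto simp: proper_edge_coloring_iff edge_colorable_def)
    qed
  qed (use K in simp)
  then show ?thesis by simp
qed

theorem theorem1p1:
  fixes G :: "'a ugraph" and q :: nat
  assumes "q \<ge> 3"
    and "fin_simple_graph G"
    and "class_one G"
    and "max_degree G \<ge> 5"
    and "\<And>B. block_of B G \<Longrightarrow>
           bipartite_graph B \<or> (degenerate (q + 1) B \<and> B \<in> class_A q)"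
  shows "chi_trans G \<le> q + 1"
proof -
  interpret sparse_colorable G q "chromatic_index G"
  proof
    show "finite (uedges G)" using assms(2) by (rule finite_uedges)
    show "card e = 2" if "e \<in> uedges G" for e using that assms(2) by (auto simp: fin_simple_graph_def)
    show "q \<ge> 3" by fact
    show "edge_colorable K q" if "K \<subseteq> uedges G" "\<And>v. edeg K v \<le> q" for K
      using edge_colorable_if_blocks[OF assms(2) _ that] assms(5) by blast
  qed
  have "n_equivalent G (chromatic_index G) (q + 1) f g"
    if f: "proper_edge_coloring G (chromatic_index G) f"
      and g: "proper_edge_coloring G (chromatic_index G) g" for f g
  proof (rule n_equivalent_if_recolor_steps[OF _ f])
    show "(recolor_step G (chromatic_index G) (q + 1))\<^sup>*\<^sup>* f g"
    \<comment> \<open>At the start all colors are open, so \<open>T\<close> is the whole color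
      set.\<close>
    proof (rule recolor_between[OF order_refl f g])
      fix e assume "e \<in> uedges G"
      then show "f e = g e \<or> f e \<in> {1..chromatic_index G} \<and> g e \<in> {1..chromatic_index G}"
        using f g by (auto simp: proper_edge_coloring_iff PiE_def Pi_def)
    qed
  qed
  then show ?thesis
    unfolding chi_trans_def using assms(1) by (intro Least_le) auto
qed

end
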